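(* For any $m\ge 2$ there exist $m$ torus bundles over the circle whose fundamental groups have isomorphic profinite completions although these fundamental groups are pairwise non-isomorphic.
   Context: Torus bundles over the circle are the mapping tori $M_A$ of matrices $A\in SL(2,\mathbb{Z})$ acting on $\mathbb{R}^2/\mathbb{Z}^2$. *)

theory Defs
  imports "HOL-Analysis.Analysis" "HOL-Algebra.Product_Groups"
begin

section \<open>Quotient spaces and mapping tori\<close>

text \<open>
  Meant for \<^term>\<open>r\<close> an equivalence relation on \<^term>\<open>topspace X\<close>.  The points are the
  equivalence classes, so \<^term>\<open>\<Union>U\<close> is the preimage of \<^term>\<open>U\<close> under the projection.
\<close>

definition quotient_topology :: "'a topology \<Rightarrow> ('a \<times> 'a) set \<Rightarrow> 'a set topology" where
  "quotient_topology X r = topology (\<lambda>U. U \<subseteq> topspace X // r \<and> openin X (\<Union>U))"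

lemma openin_quotient_topology:
  assumes "equiv (topspace X) r"
  shows "openin (quotient_topology X r) U \<longleftrightarrow> U \<subseteq> topspace X // r \<and> openin X (\<Union>U)"
proof -
  have Int: "\<Union>(S \<inter> T) = \<Union>S \<inter> \<Union>T"
    if "S \<subseteq> topspace X // r" "T \<subseteq> topspace X // r" for S T
  proof
    show "\<Union>S \<inter> \<Union>T \<subseteq> \<Union>(S \<inter> T)"
    proof
      fix x assume "x \<in> \<Union>S \<inter> \<Union>T"
      then obtain c d where "c \<in> S" "d \<in> T" "x \<in> c" "x \<in> d" by auto
      moreover from this have "c = d"
        using quotient_disj[OF assms, of c d] that by blast
      ultimately show "x \<in> \<Union>(S \<inter> T)" by blast
    qed
  qed blast
  have "istopology (\<lambda>U. U \<subseteq> topspace X // r \<and> openin X (\<Union>U))"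
    unfolding istopology_def
  proof (intro conjI allI impI)
    fix S T assume "S \<subseteq> topspace X // r \<and> openin X (\<Union>S)" "T \<subseteq> topspace X // r \<and> openin X (\<Union>T)"
    then show "S \<inter> T \<subseteq> topspace X // r" "openin X (\<Union>(S \<inter> T))"
      by (auto simp: Int)
  next
    fix K assume K: "\<forall>U\<in>K. U \<subseteq> topspace X // r \<and> openin X (\<Union>U)"
    then show "\<Union>K \<subseteq> topspace X // r" by blast
    have "\<Union>(\<Union>K) = (\<Union>U\<in>K. \<Union>U)" by blast
    then show "openin X (\<Union>(\<Union>K))" using K by auto
  qed
  then show ?thesis by (simp add: quotient_topology_def)
qed

lemma topspace_quotient_topology:
  assumes "equiv (topspace X) r"
  shows "topspace (quotient_topology X r) = topspace X // r"
proof -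
  have "\<Union>(topspace X // r) = topspace X"
    using assms by (rule Union_quotient)
  then have "openin (quotient_topology X r) (topspace X // r)"
    by (simp add: openin_quotient_topology[OF assms])
  then show ?thesis
    by (metis assms openin_quotient_topology openin_subset openin_topspace subset_antisym)
qed

text \<open>\<open>X \<times> [0,1]\<close> modulo the equivalence relation generated by \<open>(x, 1) \<sim> (f x, 0)\<close>.\<close>

definition mapping_torus_rel :: "'a topology \<Rightarrow> ('a \<Rightarrow> 'a) \<Rightarrow> (('a \<times> real) \<times> ('a \<times> real)) set" where
  "mapping_torus_rel X f =
     {(p, q). p \<in> topspace X \<times> {0..1} \<and> q \<in> topspace X \<times> {0..1} \<and>
              equivclp (\<lambda>p q. \<exists>x\<in>topspace X. p = (x, 1) \<and> q = (f x, 0)) p q}"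

definition mapping_torus :: "'a topology \<Rightarrow> ('a \<Rightarrow> 'a) \<Rightarrow> ('a \<times> real) set topology" where
  "mapping_torus X f =
     quotient_topology (prod_topology X (top_of_set {0..1})) (mapping_torus_rel X f)"

lemma equiv_mapping_torus_rel:
  "equiv (topspace (prod_topology X (top_of_set {0..1}))) (mapping_torus_rel X f)"
  by (rule equivI)
     (auto simp: mapping_torus_rel_def refl_on_def intro!: symI transI
           intro: equivclp_sym equivclp_trans)


section \<open>Torus bundles over the circle\<close>

definition torus_rel :: "((real^2) \<times> (real^2)) set" where
  "torus_rel = {(v, w). \<forall>i. v $ i - w $ i \<in> \<int>}"

definition torus :: "(real^2) set topology" where
  "torus = quotient_topology euclidean torus_rel"

lemma equiv_torus_rel: "equiv (topspace euclidean) torus_rel"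
proof (rule equivI)
  show "refl_on (topspace euclidean) torus_rel"
    by (auto simp: torus_rel_def refl_on_def)
  show "sym torus_rel"
    by (auto simp: torus_rel_def intro!: symI) (metis Ints_minus minus_diff_eq)
  show "trans torus_rel"
    by (auto simp: torus_rel_def intro!: transI) (metis Ints_add diff_add_cancel add_diff_eq)
qed auto

text \<open>
  For \<^term>\<open>A\<close> of determinant 1, the linear map permutes the cosets of the integer lattice; its
  action on the torus is given by images of cosets.
\<close>

definition torus_action :: "int^2^2 \<Rightarrow> (real^2) set \<Rightarrow> (real^2) set" where
  "torus_action A c = (\<lambda>v. map_matrix real_of_int A *v v) ` c"

definition torus_bundle :: "int^2^2 \<Rightarrow> ((real^2) set \<times> real) set topology" where
  "torus_bundle A = mapping_torus torus (torus_action A)"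

lemma topspace_torus: "topspace torus = UNIV // torus_rel"
  using topspace_quotient_topology[OF equiv_torus_rel] by (simp add: torus_def)

lemma topspace_torus_bundle:
  "topspace (torus_bundle A) =
     (topspace torus \<times> {0..1}) // mapping_torus_rel torus (torus_action A)"
  using topspace_quotient_topology[OF equiv_mapping_torus_rel[of torus "torus_action A"]]
  by (simp add: torus_bundle_def mapping_torus_def)

lemma topspace_torus_bundle_nonempty: "topspace (torus_bundle A) \<noteq> {}"
  by (auto simp: topspace_torus_bundle topspace_torus quotient_def)


section \<open>The fundamental group\<close>

text \<open>
  \<^const>\<open>joinpaths\<close> and \<^const>\<open>homotopic_paths\<close> are confined to type class topologies;
  these are their counterparts for spaces of type \<^typ>\<open>'a topology\<close>.  As there, a path is a
  function on all reals whose values outside the unit interval are irrelevant: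
  loops that agree on the unit interval are homotopic.
\<close>

definition loops_at :: "'a topology \<Rightarrow> 'a \<Rightarrow> (real \<Rightarrow> 'a) set" where
  "loops_at X x = {p. pathin X p \<and> p 0 = x \<and> p 1 = x}"

definition loop_concat :: "(real \<Rightarrow> 'a) \<Rightarrow> (real \<Rightarrow> 'a) \<Rightarrow> real \<Rightarrow> 'a" where
  "loop_concat p q = (\<lambda>t. if t \<le> 1/2 then p (2 * t) else q (2 * t - 1))"

definition loop_homotopy_rel :: "'a topology \<Rightarrow> 'a \<Rightarrow> ((real \<Rightarrow> 'a) \<times> (real \<Rightarrow> 'a)) set" where
  "loop_homotopy_rel X x =
     {(p, q). p \<in> loops_at X x \<and> q \<in> loops_at X x \<and>
              homotopic_with (\<lambda>r. r 0 = x \<and> r 1 = x) (top_of_set {0..1}) X p q}"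

definition fundamental_group :: "'a topology \<Rightarrow> 'a \<Rightarrow> (real \<Rightarrow> 'a) set monoid" where
  "fundamental_group X x =
     \<lparr>carrier = loops_at X x // loop_homotopy_rel X x,
      monoid.mult = (\<lambda>P Q. \<Union>p\<in>P. \<Union>q\<in>Q. loop_homotopy_rel X x `` {loop_concat p q}),
      one = loop_homotopy_rel X x `` {\<lambda>_. x}\<rparr>"


section \<open>Profinite completions\<close>

definition finite_index_normal_subgroups :: "('a, 'b) monoid_scheme \<Rightarrow> 'a set set" where
  "finite_index_normal_subgroups G = {N. N \<lhd> G \<and> finite (rcosets\<^bsub>G\<^esub> N)}"

text \<open>
  The inverse limit of the finite quotients of \<^term>\<open>G\<close>, as a group of compatible families.
  For \<^term>\<open>N \<subseteq> M\<close> the canonical projection \<^term>\<open>G Mod N\<close> to \<^term>\<open>G Mod M\<close> sends a coset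
  \<^term>\<open>C\<close> to \<open>C <#> M\<close>.
\<close>

definition profinite_completion :: "('a, 'b) monoid_scheme \<Rightarrow> ('a set \<Rightarrow> 'a set) monoid" where
  "profinite_completion G =
     product_group (finite_index_normal_subgroups G) (\<lambda>N. G Mod N)
       \<lparr>carrier := {f \<in> carrier (product_group (finite_index_normal_subgroups G) (\<lambda>N. G Mod N)).
          \<forall>N\<in>finite_index_normal_subgroups G. \<forall>M\<in>finite_index_normal_subgroups G.
            N \<subseteq> M \<longrightarrow> f N <#>\<^bsub>G\<^esub> M = f M}\<rparr>"

definition profinite_topology :: "('a, 'b) monoid_scheme \<Rightarrow> ('a set \<Rightarrow> 'a set) topology" where
  "profinite_topology G =
     subtopology
       (product_topology (\<lambda>N. discrete_topology (carrier (G Mod N)))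
          (finite_index_normal_subgroups G))
       (carrier (profinite_completion G))"

text \<open>Isomorphism of profinite completions is isomorphism of topological groups.\<close>

definition isomorphic_profinite_completions ::
    "('a, 'c) monoid_scheme \<Rightarrow> ('b, 'd) monoid_scheme \<Rightarrow> bool" where
  "isomorphic_profinite_completions G H \<longleftrightarrow>
     (\<exists>\<phi> \<in> iso (profinite_completion G) (profinite_completion H).
        homeomorphic_map (profinite_topology G) (profinite_topology H) \<phi>)"

end

theory Submission
  imports Defs "HOL-Number_Theory.Cong" "HOL-Algebra.Multiplicative_Group"
begin

text \<open>
  The torus bundle of \<open>A\<close> is the quotient of \<open>\<real>\<^sup>2 \<times> \<real>\<close> by a free action of \<open>\<int>\<^sup>2 \<rtimes> \<int>\<close>, with \<open>\<int>\<close> acting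
  on \<open>\<int>\<^sup>2\<close> through \<open>A\<close>, so this is its fundamental group.  The orbit map is realised as a map into
  a Euclidean space, so that the lifting theorems for covering spaces apply to it.

  For hyperbolic \<open>A\<close> and \<open>B\<close>, an isomorphism of semidirect products preserves \<open>\<int>\<^sup>2\<close>, so it yields an
  integer matrix of determinant \<open>\<plusminus>1\<close> that conjugates \<open>A\<close> to \<open>B\<close> or to its inverse.  For matrices
  \<open>((a, b), (c, a))\<close> with \<open>b c = a\<^sup>2 - 1\<close> such a conjugation from \<open>(b, c)\<close> to \<open>(b', c')\<close> makes
  \<open>c c'\<close> or its negative a value of the Pell form \<open>X\<^sup>2 - (a\<^sup>2 - 1) Y\<^sup>2\<close>, whose values of absolute value
  below \<open>2 a - 2\<close> are squares.  On the other hand, if \<open>b\<close> and \<open>c\<close> are coprime, the matrix is conjugate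
  over the profinite integers to the one with \<open>c = 1\<close>.  The values \<open>c\<close> are taken to be distinct odd
  primes dividing \<open>a - 1\<close>.
\<close>

section \<open>Small values of the Pell form\<close>

text \<open>For \<open>c' = 1\<close> and nonzero \<open>c\<close> the integer solutions
  \<open>P\<close> of \<open>P ** A = B ** P\<close> are exactly s times the matrix ((c, 0), (0, 1))
  plus r times ((0, b), (1, 0)), of determinant c s^2 - b r^2. Integral conjugacy asks this form for
  the value 1 or -1, and c times the form is (c s)^2 - (a^2 - 1) r^2, whence the Pell form. Locally
  there is no obstruction: c and -b are themselves values, and if they are coprime, at least one of
  them is a unit at each prime. The examples live in this gap between local and global values of one
  form.

  No profinite integers are constructed. The local choices are patched by an integer sequence, and
  each matrix of the resulting sequence intertwines \<open>A\<close> and \<open>B\<close> exactly,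
  so that it induces a homomorphism of semidirect products. Only invertibility is approximate:
  modulo every n it holds from some index on.\<close>

lemma pell_small_value_is_square:
  fixes a X Y v :: int
  assumes "X\<^sup>2 - (a\<^sup>2 - 1) * Y\<^sup>2 = v" "\<bar>v\<bar> < 2 * a - 2"
  shows "\<exists>z. v = z\<^sup>2"
  using assms(1)
proof (induction "nat \<bar>Y\<bar>" arbitrary: X Y rule: less_induct)
  case less
  show ?case
  proof (cases "Y = 0")
    case True
    then show ?thesis using less.prems by auto
  next
    case False
    define x y where "x = \<bar>X\<bar>" and "y = \<bar>Y\<bar>"
    have "y > 0" "x \<ge> 0" using False by (auto simp: x_def y_def)
    have eq: "x\<^sup>2 - (a\<^sup>2 - 1) * y\<^sup>2 = v" using less.prems by (simp add: x_def y_def)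
    have "a > 1" using assms(2) by linarith
    have y2: "y\<^sup>2 \<ge> 1" using \<open>y > 0\<close> by (smt (verit) zero_less_power)
    have "(2 * a - 2) * 1 \<le> (2 * a - 2) * y\<^sup>2"
      using y2 \<open>a > 1\<close> by (intro mult_left_mono) auto
    then have b: "\<bar>v\<bar> < (2 * a - 2) * y\<^sup>2" using assms(2) by simp
    \<comment> \<open>The bound on \<open>v\<close> puts \<open>x\<close> strictly between (a - 1) y
      and (a + 1) y, so that \<open>a * y - x\<close> can replace \<open>Y\<close> in a descent. The
      lower end is where 2 a - 2 comes from: (a^2 - 1) - (2 a - 2) = (a - 1)^2.\<close>
    have "x\<^sup>2 < ((a + 1) * y)\<^sup>2"
      using b eq y2 by (simp add: power2_eq_square algebra_simps abs_if split: if_splits)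
    then have "x < (a + 1) * y"
      by (rule power_less_imp_less_base) (use \<open>a > 1\<close> \<open>y > 0\<close> in simp)
    moreover have "((a - 1) * y)\<^sup>2 < x\<^sup>2"
      using b eq y2 by (simp add: power2_eq_square algebra_simps abs_if split: if_splits)
    then have "(a - 1) * y < x"
      using \<open>x \<ge> 0\<close> by (rule power_less_imp_less_base)
    ultimately have "\<bar>a * y - x\<bar> < y" by (simp add: algebra_simps abs_if)
    then have "nat \<bar>a * y - x\<bar> < nat \<bar>Y\<bar>" by (simp add: y_def)
    \<comment> \<open>multiplication by the unit \<open>a - sqrt (a\<^sup>2 - 1)\<close>\<close>
    moreover have "(a * x - (a\<^sup>2 - 1) * y)\<^sup>2 - (a\<^sup>2 - 1) * (a * y - x)\<^sup>2 = v"
      unfolding eq[symmetric] by (simp add: power2_eq_square algebra_simps)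
    ultimately show ?thesis using less.hyps by blast
  qed
qed

text \<open>In a square the multiplicity of \<open>p\<close> is even; here it is 1.\<close>

lemma prime_mult_prime_not_square:
  fixes p q :: nat
  assumes "prime p" "prime q" "p \<noteq> q"
  shows "int p * int q \<noteq> z\<^sup>2"
proof
  assume "int p * int q = z\<^sup>2"
  then have "p * q = (nat \<bar>z\<bar>)\<^sup>2"
    by (metis abs_of_nat int_nat_eq nat_int of_nat_mult of_nat_power power2_abs abs_ge_zero of_nat_eq_iff)
  then have "multiplicity p (p * q) = 2 * multiplicity p (nat \<bar>z\<bar>)"
    using assms by (metis mult_eq_0_iff not_prime_0 prime_elem_multiplicity_power_distrib
      prime_imp_prime_elem zero_eq_power2)
  moreover have "multiplicity p (p * q) = 1"
    using assms by (subst prime_elem_multiplicity_mult_distrib)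
      (auto simp: prime_multiplicity_other)
  ultimately show False by presburger
qed


section \<open>Integer powers of matrices\<close>

text \<open>As a monoid record it obtains powers with negative exponents, and their laws, from
  \<open>[^]\<close>; these powers are meaningful for determinant 1 only.\<close>

definition SL2 :: "(int^2^2) monoid" where
  "SL2 = \<lparr>carrier = {A. det A = 1}, monoid.mult = (**), one = mat 1\<rparr>"

lemma one_SL2 [simp]: "\<one>\<^bsub>SL2\<^esub> = mat 1"
  by (simp add: SL2_def)

abbreviation mat_pow :: "int^2^2 \<Rightarrow> int \<Rightarrow> int^2^2" (infixr "[**]" 75) where
  "A [**] k \<equiv> A [^]\<^bsub>SL2\<^esub> k"

text \<open>The adjugate: the inverse in determinant 1, but also applied to \<open>A - mat 1\<close>
  and to intertwining matrices of other determinants.\<close>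

definition adj2 :: "int^2^2 \<Rightarrow> int^2^2" where
  "adj2 A = vector [vector [A$2$2, - A$1$2], vector [- A$2$1, A$1$1]]"

lemma matrix_mult_2: "(A ** B) $ i $ j = A$i$1 * B$1$j + A$i$2 * B$2$j"
  for A B :: "'a::semiring_1^2^2"
  by (simp add: matrix_matrix_mult_def sum_2)

lemma adj2_mult: "adj2 A ** A = mat (det A)" "A ** adj2 A = mat (det A)"
  by (simp_all add: vec_eq_iff forall_2 matrix_mult_2 adj2_def vector_2 mat_def det_2 algebra_simps)

lemma group_SL2: "group SL2"
proof (rule groupI)
  show "\<exists>B\<in>carrier SL2. B \<otimes>\<^bsub>SL2\<^esub> A = \<one>\<^bsub>SL2\<^esub>" if "A \<in> carrier SL2" for A
    using that adj2_mult[of A]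
    by (intro bexI[of _ "adj2 A"]) (auto simp: SL2_def adj2_def det_2 vector_2 algebra_simps)
qed (auto simp: SL2_def det_mul matrix_mul_assoc)

lemma
  assumes "det A = 1"
  shows mat_pow_add: "A [**] (i + j) = A [**] i ** A [**] j"
    and mat_pow_0: "A [**] 0 = mat 1"
    and mat_pow_1: "A [**] 1 = A"
    and mat_pow_neg_1: "A [**] (- 1) = adj2 A"
proof -
  interpret group SL2 by (rule group_SL2)
  have A: "A \<in> carrier SL2" using assms by (simp add: SL2_def)
  show add: "A [**] (i + j) = A [**] i ** A [**] j"  for i j
    using int_pow_mult[OF A, of i j] by (simp add: SL2_def)
  show 0: "A [**] 0 = mat 1" by (simp add: SL2_def)
  show 1: "A [**] 1 = A" using int_pow_1[OF A] .
  have "A [**] (- 1) = A [**] (-1) ** (A ** adj2 A)"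
    using adj2_mult assms by simp
  also have "\<dots> = adj2 A"
    using add[of "-1" 1] 0 1 by (metis add.left_inverse matrix_mul_assoc matrix_mul_lid)
  finally show "A [**] (- 1) = adj2 A" .
qed

lemma mat_pow_cancel:
  assumes "det A = 1"
  shows "A [**] (- k) ** A [**] k = mat 1" "A [**] k ** A [**] (- k) = mat 1"
  using assms by (simp_all flip: mat_pow_add add: mat_pow_0)

text \<open>\<open>P\<close> may be singular over the integers, since it will be a matrix whose
  determinant is a unit only modulo given integers. For negative exponents it is the powers of
  \<open>A\<close> and \<open>B\<close> that are cancelled.\<close>

lemma mat_pow_intertwine:
  assumes "det A = 1" "det B = 1" and PA: "P ** A = B ** P"
  shows "P ** A [**] k = B [**] k ** P"
proof -
  have nat: "P ** A [**] (int n) = B [**] (int n) ** P" for n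
  proof (induction n)
    case (Suc n)
    have "P ** A [**] (int (Suc n)) = (P ** A [**] (int n)) ** A"
      using mat_pow_add[OF assms(1), of "int n" 1] mat_pow_1[OF assms(1)]
      by (simp add: matrix_mul_assoc add.commute)
    also have "\<dots> = B [**] (int n) ** (P ** A)"
      by (simp only: Suc matrix_mul_assoc)
    also have "\<dots> = B [**] (int (Suc n)) ** P"
      unfolding PA using mat_pow_add[OF assms(2), of "int n" 1] mat_pow_1[OF assms(2)]
      by (simp add: matrix_mul_assoc add.commute)
    finally show ?case .
  qed (simp add: mat_pow_0 assms)
  show ?thesis
  proof (cases k)
    case (neg n)
    define l where "l = int (Suc n)"
    have "P ** A [**] (- l) = B [**] (- l) ** (B [**] l ** P) ** A [**] (- l)"
      by (simp add: matrix_mul_assoc mat_pow_cancel assms)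
    also have "B [**] l ** P = P ** A [**] l" using nat[of "Suc n"] by (simp add: l_def)
    also have "B [**] (- l) ** (P ** A [**] l) ** A [**] (- l) =
        B [**] (- l) ** P ** (A [**] l ** A [**] (- l))"
      by (simp add: matrix_mul_assoc)
    also have "\<dots> = B [**] (- l) ** P" by (simp add: mat_pow_cancel assms)
    finally show ?thesis by (simp add: neg l_def)
  qed (use nat in simp)
qed


section \<open>The semidirect product\<close>

definition semidirect :: "int^2^2 \<Rightarrow> ((int^2) \<times> int) monoid" where
  "semidirect A = \<lparr>carrier = UNIV,
     monoid.mult = (\<lambda>(v, i) (w, j). (v + A [**] i *v w, i + j)), one = (0, 0)\<rparr>"

lemma semidirect_simps [simp]:
  "carrier (semidirect A) = UNIV"
  "(v, i) \<otimes>\<^bsub>semidirect A\<^esub> (w, j) = (v + A [**] i *v w, i + j)"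
  "\<one>\<^bsub>semidirect A\<^esub> = (0, 0)"
  by (simp_all add: semidirect_def)

lemma group_semidirect:
  assumes "det A = 1"
  shows "group (semidirect A)"
proof (rule groupI)
  show "\<exists>y\<in>carrier (semidirect A). y \<otimes>\<^bsub>semidirect A\<^esub> x = \<one>\<^bsub>semidirect A\<^esub>" for x
    by (cases x, rule bexI[of _ "(- (A [**] (- snd x) *v fst x), - snd x)"]) auto
  show "x \<otimes>\<^bsub>semidirect A\<^esub> y \<otimes>\<^bsub>semidirect A\<^esub> z = x \<otimes>\<^bsub>semidirect A\<^esub> (y \<otimes>\<^bsub>semidirect A\<^esub> z)" for x y z
    by (cases x; cases y; cases z)
       (simp add: mat_pow_add assms matrix_vector_mul_assoc matrix_vector_right_distrib)
  show "\<one>\<^bsub>semidirect A\<^esub> \<otimes>\<^bsub>semidirect A\<^esub> x = x" for x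
    by (cases x) (simp add: mat_pow_0 assms)
qed auto

lemma semidirect_hom:
  assumes "det A = 1" "det B = 1" "P ** A = B ** P"
  shows "(\<lambda>(v, k). (P *v v, k)) \<in> hom (semidirect A) (semidirect B)"
  by (rule homI)
     (auto simp: matrix_vector_right_distrib matrix_vector_mul_assoc mat_pow_intertwine[OF assms])

lemma semidirect_inv:
  assumes "det A = 1"
  shows "inv\<^bsub>semidirect A\<^esub> (v, k) = (- (A [**] (- k) *v v), - k)"
proof -
  interpret group "semidirect A" using assms by (rule group_semidirect)
  show ?thesis by (rule inv_equality) auto
qed

lemma semidirect_pow:
  assumes "det A = 1"
  shows "(v, 0) [^]\<^bsub>semidirect A\<^esub> (n :: nat) = (of_nat n *s v, 0)"
proof -
  interpret group "semidirect A" using assms by (rule group_semidirect)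
  show ?thesis
    by (induction n) (auto simp: mat_pow_0 assms vec_eq_iff algebra_simps)
qed


section \<open>Profinite completions and convergent sequences of homomorphisms\<close>

lemma (in group) rcos_eq_iff:
  assumes "subgroup H G" "x \<in> carrier G" "y \<in> carrier G"
  shows "H #> x = H #> y \<longleftrightarrow> x \<otimes> inv y \<in> H"
  using assms
  by (metis coset_join1 coset_join2 coset_mult_assoc coset_mult_inv2 coset_mult_one inv_closed
      m_closed r_inv subgroup.subset coset_mult_inv1)

lemma (in group) rcosets_representative:
  assumes "subgroup H G" "C \<in> rcosets H" "x \<in> C"
  shows "x \<in> carrier G" "C = H #> x"
proof -
  obtain y where y: "y \<in> carrier G" "C = H #> y" using assms(2) by (auto simp: RCOSETS_def)
  show "x \<in> carrier G"
    using subgroup.elemrcos_carrier[OF assms(1) group_axioms y(1)] assms(3) y(2) by blast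
  show "C = H #> x" using repr_independence[OF _ y(1) assms(1)] assms(3) y(2) by blast
qed

text \<open>This evaluates the transition map from \<open>G Mod N\<close> to \<open>G Mod M\<close>
  of the inverse limit on a representative \<open>x\<close>.\<close>

lemma (in group) rcos_mult_normal:
  assumes N: "N \<lhd> G" and M: "M \<lhd> G" and "N \<subseteq> M" and x: "x \<in> carrier G"
  shows "(N #> x) <#> M = M #> x"
proof -
  have sub: "subgroup N G" "subgroup M G" using N M by (auto intro: normal_imp_subgroup)
  note subset = sub[THEN subgroup.subset]
  have "(N #> x) <#> M = N <#> (x <# M)"
    using x subset by (metis rcos_assoc_lcos)
  also have "x <# M = M #> x" using normal.coset_eq[OF M] x by simp
  also have "N <#> (M #> x) = (N <#> M) #> x"
    using x subset by (simp add: setmult_rcos_assoc)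
  also have "N <#> M = M"
  proof
    show "N <#> M \<subseteq> M"
      using \<open>N \<subseteq> M\<close> subgroup.m_closed[OF sub(2)] by (auto simp: set_mult_def)
    show "M \<subseteq> N <#> M"
    proof
      fix y assume "y \<in> M"
      then have "y = \<one> \<otimes> y" using subset by auto
      then show "y \<in> N <#> M"
        using subgroup.one_closed[OF sub(1)] \<open>y \<in> M\<close> unfolding set_mult_def by blast
    qed
  qed
  finally show ?thesis .
qed

lemma carrier_profinite_completion:
  "carrier (profinite_completion G) =
     {f \<in> \<Pi>\<^sub>E N\<in>finite_index_normal_subgroups G. rcosets\<^bsub>G\<^esub> N.
        \<forall>N\<in>finite_index_normal_subgroups G. \<forall>M\<in>finite_index_normal_subgroups G.
            N \<subseteq> M \<longrightarrow> f N <#>\<^bsub>G\<^esub> M = f M}"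
  by (simp add: profinite_completion_def FactGroup_def)

lemma mult_profinite_completion:
  "x \<otimes>\<^bsub>profinite_completion G\<^esub> y =
     (\<lambda>N\<in>finite_index_normal_subgroups G. x N <#>\<^bsub>G\<^esub> y N)"
  by (simp add: profinite_completion_def FactGroup_def)

text \<open>This closure is what lets the inverse of an isomorphism of completions respect
  products.\<close>

lemma (in group) profinite_completion_mult_closed:
  assumes \<xi>: "\<xi> \<in> carrier (profinite_completion G)" and \<eta>: "\<eta> \<in> carrier (profinite_completion G)"
  shows "\<xi> \<otimes>\<^bsub>profinite_completion G\<^esub> \<eta> \<in> carrier (profinite_completion G)"
proof -
  let ?I = "finite_index_normal_subgroups G"
  have rep: "\<exists>x\<in>carrier G. \<zeta> N = N #> x"
    if "N \<in> ?I" "\<zeta> \<in> carrier (profinite_completion G)" for N \<zeta>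
  proof -
    have "\<zeta> N \<in> rcosets N" using that by (auto simp: carrier_profinite_completion)
    then show ?thesis by (auto simp: RCOSETS_def)
  qed
  have closed: "\<xi> N <#> \<eta> N \<in> rcosets N \<and> (\<xi> N <#> \<eta> N) <#> M = \<xi> M <#> \<eta> M"
    if N: "N \<in> ?I" and M: "M \<in> ?I" and "N \<subseteq> M" for N M
  proof -
    obtain x y where x: "x \<in> carrier G" "\<xi> N = N #> x" and y: "y \<in> carrier G" "\<eta> N = N #> y"
      using rep[OF N \<xi>] rep[OF N \<eta>] by blast
    have n: "N \<lhd> G" "M \<lhd> G" using N M by (auto simp: finite_index_normal_subgroups_def)
    have "\<xi> M = \<xi> N <#> M" "\<eta> M = \<eta> N <#> M"
      using \<xi> \<eta> that by (simp_all add: carrier_profinite_completion)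
    then have "\<xi> M = M #> x" "\<eta> M = M #> y"
      using rcos_mult_normal[OF n \<open>N \<subseteq> M\<close>] x y by simp_all
    moreover have "(N #> (x \<otimes> y)) <#> M = M #> (x \<otimes> y)"
      using rcos_mult_normal[OF n \<open>N \<subseteq> M\<close>] x y by simp
    moreover have "N #> (x \<otimes> y) \<in> rcosets N"
      using rcosetsI[OF subgroup.subset[OF normal_imp_subgroup[OF n(1)]]] x y by simp
    ultimately show ?thesis
      using x y n by (simp add: normal.rcos_sum)
  qed
  then show ?thesis
    unfolding carrier_profinite_completion mult_profinite_completion by auto
qed

lemma topspace_profinite_topology:
  "topspace (profinite_topology G) = carrier (profinite_completion G)"
  by (auto simp: profinite_topology_def profinite_completion_def)

text \<open>Uniform convergence in the profinite topology: modulo each \<open>M\<close> the maps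
  \<open>f k\<close> are eventually one and the same map. The limit is a homomorphism of completions
  that in general no single \<open>f k\<close> induces.\<close>

locale convergent_homs = G: group G + H: group H
  for G :: "('a, 'c) monoid_scheme" (structure) and H :: "('b, 'd) monoid_scheme" (structure) +
  fixes f :: "nat \<Rightarrow> 'a \<Rightarrow> 'b"
  assumes hom: "f k \<in> hom G H"
    and convergent: "M \<in> finite_index_normal_subgroups H \<Longrightarrow>
      \<exists>K. \<forall>k\<ge>K. \<forall>x\<in>carrier G. M #>\<^bsub>H\<^esub> f k x = M #>\<^bsub>H\<^esub> f K x"
begin

definition stable_index :: "'b set \<Rightarrow> nat" where
  "stable_index M = (SOME K. \<forall>k\<ge>K. \<forall>x\<in>carrier G. M #>\<^bsub>H\<^esub> f k x = M #>\<^bsub>H\<^esub> f K x)"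

definition limit_preimage :: "'b set \<Rightarrow> 'a set" where
  "limit_preimage M = {x \<in> carrier G. f (stable_index M) x \<in> M}"

text \<open>The limit map identifies \<open>G\<close> modulo \<open>limit_preimage M\<close> with a
  subgroup of \<open>H Mod M\<close>. So the coordinate of the image at \<open>M\<close> depends
  only on the coordinate of \<open>\<xi>\<close> at \<open>limit_preimage M\<close>, and not on the
  representative chosen there.\<close>

definition completion_map :: "('a set \<Rightarrow> 'a set) \<Rightarrow> 'b set \<Rightarrow> 'b set" where
  "completion_map \<xi> = (\<lambda>M\<in>finite_index_normal_subgroups H.
     M #>\<^bsub>H\<^esub> f (stable_index M) (SOME x. x \<in> \<xi> (limit_preimage M)))"

lemma f_closed: "x \<in> carrier G \<Longrightarrow> f k x \<in> carrier H"
  using hom by (auto simp: hom_def)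

lemma f_mult: "\<lbrakk>x \<in> carrier G; y \<in> carrier G\<rbrakk> \<Longrightarrow> f k (x \<otimes>\<^bsub>G\<^esub> y) = f k x \<otimes>\<^bsub>H\<^esub> f k y"
  using hom by (auto simp: hom_def)

lemma f_inv: "x \<in> carrier G \<Longrightarrow> f k (inv\<^bsub>G\<^esub> x) = inv\<^bsub>H\<^esub> f k x"
  by (meson G.group_axioms H.group_axioms group_hom.hom_inv group_hom_axioms_def group_hom_def hom)

context
  fixes M assumes M: "M \<in> finite_index_normal_subgroups H"
begin

lemma normal_M: "M \<lhd> H" and sub_M: "subgroup M H"
  using M by (auto simp: finite_index_normal_subgroups_def normal_imp_subgroup)

lemma stable:
  assumes "k \<ge> stable_index M" "x \<in> carrier G"
  shows "M #>\<^bsub>H\<^esub> f k x = M #>\<^bsub>H\<^esub> f (stable_index M) x"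
  using someI_ex[OF convergent[OF M]] assms unfolding stable_index_def by blast

lemma mem_limit_preimage_iff:
  assumes "k \<ge> stable_index M" "x \<in> carrier G"
  shows "x \<in> limit_preimage M \<longleftrightarrow> f k x \<in> M"
  using stable[OF assms] assms f_closed sub_M
  by (metis (mono_tags, lifting) H.coset_join1 H.coset_join2 limit_preimage_def mem_Collect_eq)

text \<open>\<open>limit_preimage M\<close> is the kernel of the limit map to
  \<open>H Mod M\<close>. The subgroup property is a premise because the fact already serves in the
  proof of finite index.\<close>

lemma limit_preimage_rcos_eq_iff:
  assumes "x \<in> carrier G" "y \<in> carrier G" and sub: "subgroup (limit_preimage M) G"
  shows "limit_preimage M #>\<^bsub>G\<^esub> x = limit_preimage M #>\<^bsub>G\<^esub> y \<longleftrightarrow>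
    M #>\<^bsub>H\<^esub> f (stable_index M) x = M #>\<^bsub>H\<^esub> f (stable_index M) y"
  using assms
  by (simp add: G.rcos_eq_iff H.rcos_eq_iff[OF sub_M] f_closed f_mult f_inv
      mem_limit_preimage_iff[OF order_refl])

lemma limit_preimage_finite_index: "limit_preimage M \<in> finite_index_normal_subgroups G"
proof -
  let ?P = "limit_preimage M" and ?f = "f (stable_index M)"
  have sub: "subgroup ?P G"
  proof (rule G.subgroupI)
    have "?f \<one>\<^bsub>G\<^esub> = \<one>\<^bsub>H\<^esub>"
      using hom_one[OF hom G.group_axioms H.group_axioms] .
    then show "?P \<noteq> {}"
      using subgroup.one_closed[OF sub_M] by (auto simp: limit_preimage_def)
  qed (use sub_M in \<open>auto simp: limit_preimage_def f_mult f_inv subgroup.m_closed subgroup.m_inv_closed\<close>)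
  have "?P \<lhd> G"
    unfolding G.normal_inv_iff using sub
    by (auto simp: limit_preimage_def f_mult f_inv f_closed normal.inv_op_closed2[OF normal_M])
  moreover have "finite (rcosets\<^bsub>G\<^esub> ?P)"
  proof -
    have "rcosets\<^bsub>G\<^esub> ?P \<subseteq> (\<lambda>C. {y \<in> carrier G. M #>\<^bsub>H\<^esub> ?f y = C}) ` (rcosets\<^bsub>H\<^esub> M)"
    proof
      fix D assume "D \<in> rcosets\<^bsub>G\<^esub> ?P"
      then obtain x where x: "x \<in> carrier G" "D = ?P #>\<^bsub>G\<^esub> x" by (auto simp: RCOSETS_def)
      have "D = {y \<in> carrier G. ?P #>\<^bsub>G\<^esub> y = ?P #>\<^bsub>G\<^esub> x}"
        using x sub G.repr_independence[OF _ x(1) sub] G.rcos_self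
          subgroup.elemrcos_carrier[OF sub G.group_axioms x(1)] by blast
      also have "\<dots> = {y \<in> carrier G. M #>\<^bsub>H\<^esub> ?f y = M #>\<^bsub>H\<^esub> ?f x}"
        using limit_preimage_rcos_eq_iff[OF _ x(1) sub] by blast
      finally show "D \<in> (\<lambda>C. {y \<in> carrier G. M #>\<^bsub>H\<^esub> ?f y = C}) ` (rcosets\<^bsub>H\<^esub> M)"
        using x f_closed H.rcosetsI[OF subgroup.subset[OF sub_M]] by blast
    qed
    then show ?thesis
      using M finite_surj by (auto simp: finite_index_normal_subgroups_def)
  qed
  ultimately show ?thesis by (simp add: finite_index_normal_subgroups_def)
qed

lemma completion_map_eq:
  assumes \<xi>: "\<xi> \<in> carrier (profinite_completion G)"
    and x: "x \<in> \<xi> (limit_preimage M)" and k: "k \<ge> stable_index M"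
  shows "x \<in> carrier G" "\<xi> (limit_preimage M) = limit_preimage M #>\<^bsub>G\<^esub> x"
    "completion_map \<xi> M = M #>\<^bsub>H\<^esub> f k x"
proof -
  let ?P = "limit_preimage M"
  have sub: "subgroup ?P G"
    using limit_preimage_finite_index
    by (auto simp: finite_index_normal_subgroups_def normal_imp_subgroup)
  have "\<xi> ?P \<in> rcosets\<^bsub>G\<^esub> ?P"
    using \<xi> limit_preimage_finite_index by (auto simp: carrier_profinite_completion)
  then have *: "y \<in> carrier G \<and> \<xi> ?P = ?P #>\<^bsub>G\<^esub> y" if "y \<in> \<xi> ?P" for y
    using G.rcosets_representative[OF sub _ that] by blast
  define y where "y = (SOME x. x \<in> \<xi> ?P)"
  have y: "y \<in> \<xi> ?P" unfolding y_def using x by (rule someI)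
  show "x \<in> carrier G" "\<xi> ?P = ?P #>\<^bsub>G\<^esub> x" using *[OF x] by auto
  have "completion_map \<xi> M = M #>\<^bsub>H\<^esub> f (stable_index M) y"
    using M by (simp add: completion_map_def y_def)
  also have "\<dots> = M #>\<^bsub>H\<^esub> f (stable_index M) x"
    using limit_preimage_rcos_eq_iff[OF _ _ sub, of y x] *[OF x] *[OF y] by auto
  finally show "completion_map \<xi> M = M #>\<^bsub>H\<^esub> f k x"
    using stable[OF k] *[OF x] by simp
qed

lemma ex_representative:
  assumes \<xi>: "\<xi> \<in> carrier (profinite_completion G)"
  obtains x where "x \<in> \<xi> (limit_preimage M)" "x \<in> carrier G"
proof -
  let ?P = "limit_preimage M"
  have sub: "subgroup ?P G"
    using limit_preimage_finite_index
    by (auto simp: finite_index_normal_subgroups_def normal_imp_subgroup)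
  have "\<xi> ?P \<in> rcosets\<^bsub>G\<^esub> ?P"
    using \<xi> limit_preimage_finite_index by (auto simp: carrier_profinite_completion)
  then show ?thesis
    using that G.rcos_self[OF _ sub] by (auto simp: RCOSETS_def)
qed

end

lemma completion_map_closed:
  assumes \<xi>: "\<xi> \<in> carrier (profinite_completion G)"
  shows "completion_map \<xi> \<in> carrier (profinite_completion H)"
proof -
  let ?I = "finite_index_normal_subgroups H"
  have "completion_map \<xi> M \<in> rcosets\<^bsub>H\<^esub> M" if M: "M \<in> ?I" for M
  proof -
    obtain x where x: "x \<in> \<xi> (limit_preimage M)" "x \<in> carrier G" using ex_representative[OF M \<xi>] .
    then show ?thesis
      using completion_map_eq(3)[OF M \<xi> x(1) order_refl] f_closed
        H.rcosetsI[OF subgroup.subset[OF sub_M[OF M]]] by auto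
  qed
  moreover have "completion_map \<xi> \<in> extensional ?I" by (simp add: completion_map_def)
  moreover have "completion_map \<xi> M <#>\<^bsub>H\<^esub> M' = completion_map \<xi> M'"
    if M: "M \<in> ?I" and M': "M' \<in> ?I" and "M \<subseteq> M'" for M M'
  proof -
    \<comment> \<open>One index beyond both thresholds, so that the same \<open>f k\<close> computes
      the coordinates at \<open>M\<close> and at \<open>M'\<close>.\<close>
    define k where "k = max (stable_index M) (stable_index M')"
    have k: "k \<ge> stable_index M" "k \<ge> stable_index M'" by (auto simp: k_def)
    obtain x where x: "x \<in> \<xi> (limit_preimage M)" "x \<in> carrier G" using ex_representative[OF M \<xi>] .
    have "limit_preimage M \<subseteq> limit_preimage M'"
    proof
      fix z assume z: "z \<in> limit_preimage M"
      then have "z \<in> carrier G" by (simp add: limit_preimage_def)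
      then show "z \<in> limit_preimage M'"
        using z mem_limit_preimage_iff[OF M k(1)] mem_limit_preimage_iff[OF M' k(2)] \<open>M \<subseteq> M'\<close> by blast
    qed
    then have "\<xi> (limit_preimage M) <#>\<^bsub>G\<^esub> limit_preimage M' = \<xi> (limit_preimage M')"
      using \<xi> limit_preimage_finite_index[OF M] limit_preimage_finite_index[OF M']
      by (simp add: carrier_profinite_completion)
    moreover have "\<one>\<^bsub>G\<^esub> \<in> limit_preimage M'"
      using limit_preimage_finite_index[OF M']
      by (auto simp: finite_index_normal_subgroups_def dest!: normal_imp_subgroup subgroup.one_closed)
    \<comment> \<open>Multiplied by the unit element of \<open>limit_preimage M'\<close>,
      \<open>x\<close> stays \<open>x\<close>, so one representative serves both
      coordinates.\<close>
    ultimately have x': "x \<in> \<xi> (limit_preimage M')"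
      by (smt (verit) x G.r_one[OF x(2)] set_mult_def UN_I singletonI)
    have fx: "f k x \<in> carrier H" using f_closed x by blast
    have "(M #>\<^bsub>H\<^esub> f k x) <#>\<^bsub>H\<^esub> M' = M' #>\<^bsub>H\<^esub> f k x"
      by (rule H.rcos_mult_normal[OF normal_M[OF M] normal_M[OF M'] \<open>M \<subseteq> M'\<close> fx])
    then show ?thesis
      using completion_map_eq(3)[OF M \<xi> x(1) k(1)] completion_map_eq(3)[OF M' \<xi> x' k(2)] by simp
  qed
  ultimately show ?thesis
    by (auto simp: carrier_profinite_completion PiE_iff)
qed

lemma completion_map_hom: "completion_map \<in> hom (profinite_completion G) (profinite_completion H)"
proof (rule homI)
  fix \<xi> \<eta> assume \<xi>: "\<xi> \<in> carrier (profinite_completion G)" and \<eta>: "\<eta> \<in> carrier (profinite_completion G)"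
  show "completion_map (\<xi> \<otimes>\<^bsub>profinite_completion G\<^esub> \<eta>) =
    completion_map \<xi> \<otimes>\<^bsub>profinite_completion H\<^esub> completion_map \<eta>"
  proof (rule extensionalityI[of _ "finite_index_normal_subgroups H"])
    fix M assume M: "M \<in> finite_index_normal_subgroups H"
    obtain x where x: "x \<in> \<xi> (limit_preimage M)" "x \<in> carrier G" using ex_representative[OF M \<xi>] .
    obtain y where y: "y \<in> \<eta> (limit_preimage M)" "y \<in> carrier G" using ex_representative[OF M \<eta>] .
    let ?P = "limit_preimage M"
    have P: "?P \<in> finite_index_normal_subgroups G" by (rule limit_preimage_finite_index[OF M])
    then have nP: "?P \<lhd> G" by (auto simp: finite_index_normal_subgroups_def)
    have eq: "(\<xi> \<otimes>\<^bsub>profinite_completion G\<^esub> \<eta>) ?P = ?P #>\<^bsub>G\<^esub> (x \<otimes>\<^bsub>G\<^esub> y)"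
      using P completion_map_eq(2)[OF M \<xi> x(1) order_refl] completion_map_eq(2)[OF M \<eta> y(1) order_refl]
        normal.rcos_sum[OF nP x(2) y(2)]
      by (simp add: mult_profinite_completion)
    define z where "z = (SOME z. z \<in> ?P #>\<^bsub>G\<^esub> (x \<otimes>\<^bsub>G\<^esub> y))"
    have sub: "subgroup ?P G" using nP by (rule normal_imp_subgroup)
    have "z \<in> ?P #>\<^bsub>G\<^esub> (x \<otimes>\<^bsub>G\<^esub> y)"
      unfolding z_def using G.rcos_self[OF _ sub, of "x \<otimes>\<^bsub>G\<^esub> y"] x y by (metis G.m_closed someI_ex)
    then have "?P #>\<^bsub>G\<^esub> z = ?P #>\<^bsub>G\<^esub> (x \<otimes>\<^bsub>G\<^esub> y)" "z \<in> carrier G"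
      using G.repr_independence[OF _ _ sub] subgroup.elemrcos_carrier[OF sub G.group_axioms] x y
      by (metis G.m_closed)+
    then have "M #>\<^bsub>H\<^esub> f (stable_index M) z = M #>\<^bsub>H\<^esub> f (stable_index M) (x \<otimes>\<^bsub>G\<^esub> y)"
      using limit_preimage_rcos_eq_iff[OF M _ _ sub, of z "x \<otimes>\<^bsub>G\<^esub> y"] x y by simp
    then have "completion_map (\<xi> \<otimes>\<^bsub>profinite_completion G\<^esub> \<eta>) M =
        M #>\<^bsub>H\<^esub> (f (stable_index M) x \<otimes>\<^bsub>H\<^esub> f (stable_index M) y)"
      using M x y by (simp add: completion_map_def eq z_def f_mult)
    also have "\<dots> = completion_map \<xi> M <#>\<^bsub>H\<^esub> completion_map \<eta> M"
      using completion_map_eq(3)[OF M \<xi> x(1) order_refl] completion_map_eq(3)[OF M \<eta> y(1) order_refl]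
        normal.rcos_sum[OF normal_M[OF M]] f_closed x y by simp
    finally show "completion_map (\<xi> \<otimes>\<^bsub>profinite_completion G\<^esub> \<eta>) M =
        (completion_map \<xi> \<otimes>\<^bsub>profinite_completion H\<^esub> completion_map \<eta>) M"
      using M by (simp add: mult_profinite_completion)
  qed (simp_all add: completion_map_def mult_profinite_completion)
qed (rule completion_map_closed)

text \<open>Each coordinate of the image factors through a single coordinate of the argument, that
  is, through a map of discrete spaces.\<close>

lemma completion_map_continuous:
  "continuous_map (profinite_topology G) (profinite_topology H) completion_map"
proof -
  have "continuous_map (profinite_topology G) (discrete_topology (carrier (H Mod M)))
      (\<lambda>\<xi>. completion_map \<xi> M)" if M: "M \<in> finite_index_normal_subgroups H" for M
  proof -
    let ?P = "limit_preimage M" and ?f = "\<lambda>C. M #>\<^bsub>H\<^esub> f (stable_index M) (SOME x. x \<in> C)"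
    have P: "?P \<in> finite_index_normal_subgroups G" by (rule limit_preimage_finite_index[OF M])
    have "continuous_map (profinite_topology G) (discrete_topology (carrier (G Mod ?P))) (\<lambda>\<xi>. \<xi> ?P)"
      unfolding profinite_topology_def
      by (intro continuous_map_from_subtopology continuous_map_product_projection P)
    moreover have "continuous_map (discrete_topology (carrier (G Mod ?P)))
        (discrete_topology (carrier (H Mod M))) ?f"
    proof -
      have "?f C \<in> rcosets\<^bsub>H\<^esub> M" if "C \<in> rcosets\<^bsub>G\<^esub> ?P" for C
      proof -
        have sub: "subgroup ?P G"
          using P by (auto simp: finite_index_normal_subgroups_def normal_imp_subgroup)
        have "C \<noteq> {}" "C \<subseteq> carrier G"
          using that G.rcos_self[OF _ sub] subgroup.elemrcos_carrier[OF sub G.group_axioms]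
          by (auto simp: RCOSETS_def)
        then have "(SOME x. x \<in> C) \<in> carrier G" by (meson ex_in_conv someI_ex subset_iff)
        then show ?thesis
          using f_closed H.rcosetsI[OF subgroup.subset[OF sub_M[OF M]]] by blast
      qed
      then show ?thesis by (auto simp: FactGroup_def continuous_map_from_discrete_topology)
    qed
    ultimately have "continuous_map (profinite_topology G) (discrete_topology (carrier (H Mod M)))
        (?f \<circ> (\<lambda>\<xi>. \<xi> ?P))" by (rule continuous_map_compose)
    then show ?thesis using M by (simp add: o_def completion_map_def)
  qed
  then show ?thesis
    using completion_map_closed
    unfolding profinite_topology_def[of H] continuous_map_in_subtopology continuous_map_componentwise
    by (auto simp: completion_map_def topspace_profinite_topology)
qed

end

text \<open>Pulling \<open>N\<close> back along \<open>g\<close> and then along \<open>f\<close>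
  returns \<open>N\<close>, because \<open>g k (f k x)\<close> agrees with \<open>x\<close> modulo
  \<open>N\<close> for large \<open>k\<close>. One such \<open>k\<close> and one representative
  \<open>x\<close> then compute both sides.\<close>

lemma completion_map_inverse:
  assumes "convergent_homs G H f" "convergent_homs H G g"
    and inv: "\<And>N. N \<in> finite_index_normal_subgroups G \<Longrightarrow>
      \<exists>K. \<forall>k\<ge>K. \<forall>x\<in>carrier G. N #>\<^bsub>G\<^esub> g k (f k x) = N #>\<^bsub>G\<^esub> x"
    and \<xi>: "\<xi> \<in> carrier (profinite_completion G)"
  shows "convergent_homs.completion_map H G g (convergent_homs.completion_map G H f \<xi>) = \<xi>"
proof -
  interpret f: convergent_homs G H f by fact
  interpret g: convergent_homs H G g by fact
  let ?I = "finite_index_normal_subgroups G"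
  show ?thesis
  proof (rule extensionalityI[of _ ?I])
    show "\<xi> \<in> extensional ?I" using \<xi> by (auto simp: carrier_profinite_completion PiE_iff)
    fix N assume N: "N \<in> ?I"
    define M where "M = g.limit_preimage N"
    have M: "M \<in> finite_index_normal_subgroups H"
      unfolding M_def by (rule g.limit_preimage_finite_index[OF N])
    obtain K where K: "\<And>k x. k \<ge> K \<Longrightarrow> x \<in> carrier G \<Longrightarrow> N #>\<^bsub>G\<^esub> g k (f k x) = N #>\<^bsub>G\<^esub> x"
      using inv[OF N] by blast
    define k where "k = max K (max (f.stable_index M) (g.stable_index N))"
    have k: "k \<ge> K" "k \<ge> f.stable_index M" "k \<ge> g.stable_index N" by (auto simp: k_def)
    have sub: "subgroup N G" by (rule g.sub_M[OF N])
    have closed: "x \<in> carrier G \<Longrightarrow> f k x \<in> carrier H" "y \<in> carrier H \<Longrightarrow> g k y \<in> carrier G" for x y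
      using f.f_closed g.f_closed by auto
    have "x \<in> f.limit_preimage M \<longleftrightarrow> x \<in> N" if x: "x \<in> carrier G" for x
    proof -
      have "x \<in> f.limit_preimage M \<longleftrightarrow> g k (f k x) \<in> N"
        using f.mem_limit_preimage_iff[OF M k(2) x] g.mem_limit_preimage_iff[OF N k(3)] closed x
        by (simp add: M_def)
      also have "\<dots> \<longleftrightarrow> x \<in> N"
        using K[OF k(1) x] sub closed x by (metis f.G.coset_join1 f.G.coset_join2)
      finally show ?thesis .
    qed
    then have P: "f.limit_preimage M = N"
      using subgroup.subset[OF sub] by (auto simp: f.limit_preimage_def)
    obtain x where x: "x \<in> \<xi> (f.limit_preimage M)" "x \<in> carrier G"
      using f.ex_representative[OF M \<xi>] .
    let ?\<eta> = "f.completion_map \<xi>"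
    have \<eta>: "?\<eta> M = M #>\<^bsub>H\<^esub> f k x" by (rule f.completion_map_eq(3)[OF M \<xi> x(1) k(2)])
    have "f k x \<in> ?\<eta> (g.limit_preimage N)"
      using \<eta> f.H.rcos_self[OF _ f.sub_M[OF M]] closed x by (auto simp: M_def)
    then have "g.completion_map ?\<eta> N = N #>\<^bsub>G\<^esub> g k (f k x)"
      by (intro g.completion_map_eq(3)[OF N f.completion_map_closed[OF \<xi>] _ k(3)])
    also have "\<dots> = N #>\<^bsub>G\<^esub> x" using K k x by blast
    also have "\<dots> = \<xi> N" using f.completion_map_eq(2)[OF M \<xi> x(1) order_refl] P by simp
    finally show "g.completion_map ?\<eta> N = \<xi> N" .
  qed (simp add: g.completion_map_def)
qed

theorem isomorphic_profinite_completionsI: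
  assumes "convergent_homs G H f" "convergent_homs H G g"
    and "\<And>N. N \<in> finite_index_normal_subgroups G \<Longrightarrow>
      \<exists>K. \<forall>k\<ge>K. \<forall>x\<in>carrier G. N #>\<^bsub>G\<^esub> g k (f k x) = N #>\<^bsub>G\<^esub> x"
    and "\<And>M. M \<in> finite_index_normal_subgroups H \<Longrightarrow>
      \<exists>K. \<forall>k\<ge>K. \<forall>y\<in>carrier H. M #>\<^bsub>H\<^esub> f k (g k y) = M #>\<^bsub>H\<^esub> y"
  shows "isomorphic_profinite_completions G H"
proof -
  interpret f: convergent_homs G H f by fact
  interpret g: convergent_homs H G g by fact
  let ?\<phi> = "f.completion_map" and ?\<psi> = "g.completion_map"
  have inv: "\<xi> \<in> carrier (profinite_completion G) \<Longrightarrow> ?\<psi> (?\<phi> \<xi>) = \<xi>"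
    "\<eta> \<in> carrier (profinite_completion H) \<Longrightarrow> ?\<phi> (?\<psi> \<eta>) = \<eta>" for \<xi> \<eta>
    using completion_map_inverse[OF assms(1,2)] completion_map_inverse[OF assms(2,1)] assms(3,4) by blast+
  have "bij_betw ?\<phi> (carrier (profinite_completion G)) (carrier (profinite_completion H))"
    using inv f.completion_map_closed g.completion_map_closed
    by (intro bij_betw_byWitness[where f' = ?\<psi>]) auto
  then have "?\<phi> \<in> iso (profinite_completion G) (profinite_completion H)"
    using f.completion_map_hom by (simp add: iso_def)
  moreover have "homeomorphic_maps (profinite_topology G) (profinite_topology H) ?\<phi> ?\<psi>"
    using f.completion_map_continuous g.completion_map_continuous inv
    by (simp add: homeomorphic_maps_def topspace_profinite_topology)
  ultimately show ?thesis
    unfolding isomorphic_profinite_completions_def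
    using homeomorphic_maps_map by blast
qed

section \<open>Isomorphism of completions as an equivalence relation\<close>

lemma isomorphic_profinite_completions_trans [trans]:
  assumes "isomorphic_profinite_completions G H" "isomorphic_profinite_completions H K"
  shows "isomorphic_profinite_completions G K"
  using assms unfolding isomorphic_profinite_completions_def
  by (meson homeomorphic_map_compose iso_set_trans)

lemma isomorphic_profinite_completions_sym:
  assumes "group G" "isomorphic_profinite_completions G H"
  shows "isomorphic_profinite_completions H G"
proof -
  obtain h where h: "h \<in> iso (profinite_completion G) (profinite_completion H)"
    and "homeomorphic_map (profinite_topology G) (profinite_topology H) h"
    using assms(2) by (auto simp: isomorphic_profinite_completions_def)
  then obtain g where hg: "homeomorphic_maps (profinite_topology G) (profinite_topology H) h g"
    unfolding homeomorphic_map_maps by blast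
  then have inv: "\<xi> \<in> carrier (profinite_completion G) \<Longrightarrow> g (h \<xi>) = \<xi>"
    "\<eta> \<in> carrier (profinite_completion H) \<Longrightarrow> g \<eta> \<in> carrier (profinite_completion G)" for \<xi> \<eta>
    using continuous_map_image_subset_topspace[of "profinite_topology H" "profinite_topology G" g]
    by (auto simp: homeomorphic_maps_def topspace_profinite_topology)
  have hom: "h \<in> hom (profinite_completion G) (profinite_completion H)"
    and bij: "bij_betw h (carrier (profinite_completion G)) (carrier (profinite_completion H))"
    using h by (auto simp: iso_def)
  have "g \<in> hom (profinite_completion H) (profinite_completion G)"
  proof (rule homI)
    fix x y assume xy: "x \<in> carrier (profinite_completion H)" "y \<in> carrier (profinite_completion H)"
    then have "x \<in> h ` carrier (profinite_completion G)" "y \<in> h ` carrier (profinite_completion G)"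
      using bij_betw_imp_surj_on[OF bij] by simp_all
    then obtain u v where uv: "u \<in> carrier (profinite_completion G)" "v \<in> carrier (profinite_completion G)"
        "x = h u" "y = h v"
      by blast
    then show "g x \<in> carrier (profinite_completion G)" using inv xy by blast
    have "g (x \<otimes>\<^bsub>profinite_completion H\<^esub> y) = g (h (u \<otimes>\<^bsub>profinite_completion G\<^esub> v))"
      using hom_mult[OF hom] uv by simp
    also have "\<dots> = u \<otimes>\<^bsub>profinite_completion G\<^esub> v"
      using inv(1) group.profinite_completion_mult_closed[OF assms(1)] uv xy by blast
    finally show "g (x \<otimes>\<^bsub>profinite_completion H\<^esub> y) = g x \<otimes>\<^bsub>profinite_completion G\<^esub> g y"
      using uv xy inv by simp
  qed
  moreover have "bij_betw g (carrier (profinite_completion H)) (carrier (profinite_completion G))"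
    using hg homeomorphic_maps_sym homeomorphic_maps_map
    by (metis topspace_profinite_topology homeomorphic_imp_injective_map
        homeomorphic_imp_surjective_map bij_betw_def)
  ultimately have "g \<in> iso (profinite_completion H) (profinite_completion G)"
    by (simp add: iso_def)
  moreover have "homeomorphic_map (profinite_topology H) (profinite_topology G) g"
    using hg homeomorphic_maps_sym homeomorphic_maps_map by blast
  ultimately show ?thesis unfolding isomorphic_profinite_completions_def by blast
qed

lemma iso_imp_isomorphic_profinite_completions:
  assumes "group G" "group H" "G \<cong> H"
  shows "isomorphic_profinite_completions G H"
proof -
  obtain h where h: "h \<in> iso G H" using \<open>G \<cong> H\<close> by (auto simp: is_iso_def)
  let ?h' = "inv_into (carrier G) h"
  have h': "?h' \<in> iso H G" using group.iso_set_sym[OF assms(1) h] .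
  have inv: "x \<in> carrier G \<Longrightarrow> ?h' (h x) = x" "y \<in> carrier H \<Longrightarrow> h (?h' y) = y" for x y
    using h by (auto simp: iso_def bij_betw_def f_inv_into_f)
  show ?thesis
  proof (rule isomorphic_profinite_completionsI)
    show "convergent_homs G H (\<lambda>_. h)" "convergent_homs H G (\<lambda>_. ?h')"
      using assms(1,2) h h' by (auto simp: convergent_homs_def convergent_homs_axioms_def iso_def)
  qed (simp_all add: inv)
qed


section \<open>Isomorphisms between semidirect products\<close>

lemma additive_int_mult:
  fixes f :: "int^'n \<Rightarrow> int^'m"
  assumes "\<And>v w. f (v + w) = f v + f w"
  shows "f (c *s v) = c *s f v"
proof -
  have 0: "f 0 = 0" using assms[of 0 0] by simp
  have m: "f (- v) = - f v" for v using assms[of v "- v"] 0 by (simp add: eq_neg_iff_add_eq_0 add.commute)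
  have "f (int n *s v) = int n *s f v" for n
    by (induction n) (simp_all add: 0 assms vector_sadd_rdistrib)
  then show ?thesis
    by (cases c) (metis m vector_smult_lneg)+
qed

lemma additive_eq_matrix_mult:
  fixes f :: "int^2 \<Rightarrow> int^2"
  assumes "\<And>v w. f (v + w) = f v + f w"
  obtains P where "\<And>v. f v = P *v v"
proof
  fix v :: "int^2"
  have "v = v$1 *s axis 1 1 + v$2 *s axis 2 1"
    by (simp add: vec_eq_iff forall_2 axis_def)
  then have "f v = v$1 *s f (axis 1 1) + v$2 *s f (axis 2 1)"
    by (metis assms additive_int_mult[OF assms])
  then show "f v = (\<chi> i j. f (axis j 1) $ i) *v v"
    by (simp add: vec_eq_iff matrix_vector_mult_def sum_2 mult.commute)
qed

text \<open>
  If \<open>d = det (A - 1)\<close>, then the \<open>d\<close>-th power of \<open>(w, 0)\<close> is a commutator with \<open>(0, 1)\<close>, so it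
  vanishes in every torsion-free abelian quotient.
\<close>

lemma snd_semidirect_hom:
  assumes "det A = 1" and d: "det (A - mat 1) \<noteq> 0"
    and h: "h \<in> hom (semidirect A) (semidirect B)"
  shows "snd (h (w, 0)) = 0"
proof -
  have add: "snd (h (x \<otimes>\<^bsub>semidirect A\<^esub> y)) = snd (h x) + snd (h y)" for x y
    using hom_mult[OF h, of x y] by (cases "h x"; cases "h y") auto
  have add0: "snd (h (v + w, 0)) = snd (h (v, 0)) + snd (h (w, 0))" for v w
    using add[of "(v, 0)" "(w, 0)"] by (simp add: mat_pow_0 assms)
  \<comment> \<open>The product of \<open>(0, 1)\<close> and \<open>(u, 0)\<close> equals that of
    \<open>(A *v u - u, 0)\<close> and \<open>(u, 1)\<close>, and \<open>(u, 1)\<close> is the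
    product of \<open>(u, 0)\<close> and \<open>(0, 1)\<close>. As the second component of
    \<open>h\<close> is additive, it vanishes on the remaining factor.\<close>
  have comm: "snd (h (A *v u - u, 0)) = 0" for u
    using add[of "(0, 1)" "(u, 0)"] add[of "(A *v u - u, 0)" "(u, 1)"] add[of "(u, 0)" "(0, 1)"]
    by (simp add: mat_pow_0 mat_pow_1 assms)
  \<comment> \<open>Chosen so that (A - 1) u = det (A - 1) w.\<close>
  define u where "u = adj2 (A - mat 1) *v w"
  have "A *v u - u = (A - mat 1) *v u" by (simp add: matrix_vector_mult_diff_rdistrib)
  also have "\<dots> = mat (det (A - mat 1)) *v w"
    by (simp only: u_def matrix_vector_mul_assoc adj2_mult)
  also have "\<dots> = det (A - mat 1) *s w"
    by (simp add: vec_eq_iff matrix_vector_mult_def mat_def sum_2 forall_2)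
  finally have "snd (h (det (A - mat 1) *s w, 0)) = 0" using comm[of u] by simp
  \<comment> \<open>The integer is repeated in every entry of a vector so that
    \<open>additive_int_mult\<close> applies to an integer-valued additive map.\<close>
  moreover have "(\<chi> i. snd (h (det (A - mat 1) *s w, 0)) :: int^2) =
      det (A - mat 1) *s (\<chi> i. snd (h (w, 0)))"
    by (rule additive_int_mult) (simp add: add0 vec_eq_iff)
  ultimately show ?thesis using d by (simp add: vec_eq_iff)
qed

lemma semidirect_iso_imp_conjugate:
  assumes A: "det A = 1" "det (A - mat 1) \<noteq> 0" and B: "det B = 1" "det (B - mat 1) \<noteq> 0"
    and iso: "semidirect A \<cong> semidirect B"
  obtains P where "\<bar>det P\<bar> = 1" "P ** A = B ** P \<or> P ** A = adj2 B ** P"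
proof -
  interpret A: group "semidirect A" by (rule group_semidirect[OF A(1)])
  obtain h where h: "h \<in> iso (semidirect A) (semidirect B)" using iso by (auto simp: is_iso_def)
  define h' where "h' = inv_into (carrier (semidirect A)) h"
  have h': "h' \<in> iso (semidirect B) (semidirect A)" unfolding h'_def by (rule A.iso_set_sym[OF h])
  have bij: "bij h" using h by (simp add: iso_def)
  have inv: "h' (h x) = x" "h (h' y) = y" for x y
    using bij by (simp_all add: h'_def bij_is_inj bij_is_surj surj_f_inv_f)
  have hh: "h \<in> hom (semidirect A) (semidirect B)" "h' \<in> hom (semidirect B) (semidirect A)"
    using h h' by (auto simp: iso_def)
  have h0: "h (w, 0) = (fst (h (w, 0)), 0)" "h' (w, 0) = (fst (h' (w, 0)), 0)" for w
    using snd_semidirect_hom[OF A hh(1)] snd_semidirect_hom[OF B hh(2)] by (simp_all add: prod_eq_iff)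
  have mult: "h (x \<otimes>\<^bsub>semidirect A\<^esub> y) = h x \<otimes>\<^bsub>semidirect B\<^esub> h y"
    "h' (x \<otimes>\<^bsub>semidirect B\<^esub> y) = h' x \<otimes>\<^bsub>semidirect A\<^esub> h' y" for x y
    using hom_mult[OF hh(1)] hom_mult[OF hh(2)] by simp_all
  have "fst (h (v + w, 0)) = fst (h (v, 0)) + fst (h (w, 0))" for v w
    using mult(1)[of "(v, 0)" "(w, 0)"] h0(1)[of v] h0(1)[of w]
    by (simp add: mat_pow_0 A B) (metis fst_conv mat_pow_0 B(1) matrix_vector_mul_lid semidirect_simps(2))
  then obtain P where P: "\<And>v. fst (h (v, 0)) = P *v v"
    using additive_eq_matrix_mult[of "\<lambda>v. fst (h (v, 0))"] by blast
  have "fst (h' (v + w, 0)) = fst (h' (v, 0)) + fst (h' (w, 0))" for v w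
    using mult(2)[of "(v, 0)" "(w, 0)"] h0(2)[of v] h0(2)[of w]
    by (simp add: mat_pow_0 A B) (metis fst_conv mat_pow_0 A(1) matrix_vector_mul_lid semidirect_simps(2))
  then obtain Q where Q: "\<And>v. fst (h' (v, 0)) = Q *v v"
    using additive_eq_matrix_mult[of "\<lambda>v. fst (h' (v, 0))"] by blast
  have hP: "h (v, 0) = (P *v v, 0)" and hQ: "h' (v, 0) = (Q *v v, 0)" for v
    using h0 P Q by metis+
  have "Q *v (P *v v) = v" for v using inv(1)[of "(v, 0)"] by (simp add: hP hQ)
  then have "Q ** P = mat 1" by (simp add: matrix_eq flip: matrix_vector_mul_assoc)
  then have "det Q * det P = 1" by (metis det_I det_mul)
  then have detP: "\<bar>det P\<bar> = 1" using zmult_eq_1_iff[of "det Q" "det P"] by auto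
  \<comment> \<open>\<open>\<epsilon>\<close> is the factor by which \<open>h\<close> acts on the
    quotients by the lattice. Since \<open>h'\<close> inverts it, it is 1 or -1, which accounts for
    the two alternatives.\<close>
  define u \<epsilon> where "u = fst (h (0, 1))" and "\<epsilon> = snd (h (0, 1))"
  have ue: "h (0, 1) = (u, \<epsilon>)" by (simp add: u_def \<epsilon>_def)
  have snd_add: "snd (h (x \<otimes>\<^bsub>semidirect A\<^esub> y)) = snd (h x) + snd (h y)" for x y
    using mult(1)[of x y] by (cases "h x"; cases "h y") auto
  have "snd (h (0, k)) = k * \<epsilon>" for k
  proof -
    have "(\<chi> i. snd (h (0, (k *s axis 1 1 :: int^2) $ 1)) :: int^2) =
       k *s (\<chi> i. snd (h (0, (axis 1 1 :: int^2) $ 1)))"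
    proof (rule additive_int_mult)
      show "(\<chi> i. snd (h (0, (v + w) $ 1))) = (\<chi> i. snd (h (0, v $ 1))) + (\<chi> i. snd (h (0, w $ 1)))"
        for v w :: "int^2"
        using snd_add[of "(0, v$1)" "(0, w$1)"] by (simp add: vec_eq_iff)
    qed
    then show ?thesis by (simp add: vec_eq_iff ue)
  qed
  moreover have "snd (h (v, k)) = snd (h (0, k))" for v k
    using snd_add[of "(v, 0)" "(0, k)"] by (simp add: hP)
  ultimately have "snd (h (v, k)) = k * \<epsilon>" for v k by simp
  then have "snd (h' (0, 1)) * \<epsilon> = 1" by (metis inv(2) prod.collapse snd_conv)
  then have "\<epsilon> = 1 \<or> \<epsilon> = -1" using zmult_eq_1_iff by blast
  \<comment> \<open>\<open>h\<close> is applied to both factorizations of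
    \<open>(A *v w, 1)\<close>, one through \<open>(0, 1)\<close> and \<open>(w, 0)\<close>, the
    other through \<open>(A *v w, 0)\<close> and \<open>(0, 1)\<close>; the translation part
    \<open>u\<close> cancels.\<close>
  have "P *v (A *v w) = B [**] \<epsilon> *v (P *v w)" for w
    using mult(1)[of "(0, 1)" "(w, 0)"] mult(1)[of "(A *v w, 0)" "(0, 1)"]
    by (simp add: hP ue mat_pow_0 mat_pow_1 A B)
  then have "P ** A = B [**] \<epsilon> ** P"
    by (simp add: matrix_eq flip: matrix_vector_mul_assoc)
  then have "P ** A = B ** P \<or> P ** A = adj2 B ** P"
    using \<open>\<epsilon> = 1 \<or> \<epsilon> = -1\<close> mat_pow_1[OF B(1)] mat_pow_neg_1[OF B(1)] by auto
  then show ?thesis using that detP by blast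
qed

text \<open>With equal diagonal entries and determinant 1 the inverse stays in the family, with
  \<open>b\<close> and \<open>c\<close> negated. A single sign then covers conjugacy to a matrix and
  to its inverse.\<close>

definition mat_abc :: "int \<Rightarrow> int \<Rightarrow> int \<Rightarrow> int^2^2" where
  "mat_abc a b c = vector [vector [a, b], vector [c, a]]"

lemma mat_abc_nth [simp]:
  "mat_abc a b c $ 1 $ 1 = a" "mat_abc a b c $ 1 $ 2 = b"
  "mat_abc a b c $ 2 $ 1 = c" "mat_abc a b c $ 2 $ 2 = a"
  by (simp_all add: mat_abc_def)

lemma det_mat_abc:
  assumes "b * c = a\<^sup>2 - 1"
  shows "det (mat_abc a b c) = 1" "det (mat_abc a b c - mat 1) = 2 - 2 * a"
  using assms by (simp_all add: det_2 mat_def power2_eq_square algebra_simps)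

lemma mat_abc_isomorphic_imp_square:
  fixes a b c b' c' :: int
  assumes bc: "b * c = a\<^sup>2 - 1" "b' * c' = a\<^sup>2 - 1" and small: "0 < c * c'" "c * c' < 2 * a - 2"
    and iso: "semidirect (mat_abc a b c) \<cong> semidirect (mat_abc a b' c')"
  shows "\<exists>z. c * c' = z\<^sup>2"
proof -
  obtain P where P: "\<bar>det P\<bar> = 1" "P ** mat_abc a b c = mat_abc a b' c' ** P \<or>
      P ** mat_abc a b c = adj2 (mat_abc a b' c') ** P"
    using semidirect_iso_imp_conjugate[OF _ _ _ _ iso] det_mat_abc bc small by auto
  have adj: "adj2 (mat_abc a b' c') = mat_abc a (- b') (- c')"
    by (simp add: adj2_def mat_abc_def)
  obtain e where e: "\<bar>e\<bar> = 1" "P ** mat_abc a b c = mat_abc a (e * b') (e * c') ** P"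
    using P(2) unfolding adj by (metis abs_1 abs_minus mult_1 mult_minus1)
  define p q r s where "p = P$1$1" and "q = P$1$2" and "r = P$2$1" and "s = P$2$2"
  have qc: "q * c = e * b' * r" and sc: "s * c = e * c' * p"
    using arg_cong[OF e(2), of "\<lambda>M. M$1$1"] arg_cong[OF e(2), of "\<lambda>M. M$2$1"]
    by (simp_all add: matrix_mult_2 p_def q_def r_def s_def algebra_simps)
  \<comment> \<open>The two entry equations eliminate \<open>q\<close> and \<open>s\<close>; a
    further factor \<open>c'\<close> turns the remaining form in \<open>p\<close> and
    \<open>r\<close> into the Pell form at \<open>X = c' * p\<close>, \<open>Y = r\<close>.\<close>
  have "det P * c = p * (s * c) - r * (q * c)"
    by (simp add: det_2 p_def q_def r_def s_def algebra_simps)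
  then have "det P * c = p * (e * c' * p) - r * (e * b' * r)" by (simp only: qc sc)
  then have "det P * c * c' = (p * (e * c' * p) - r * (e * b' * r)) * c'" by simp
  also have "\<dots> = e * ((c' * p)\<^sup>2 - (b' * c') * r\<^sup>2)"
    by (simp add: power2_eq_square algebra_simps)
  finally have "det P * c * c' = e * ((c' * p)\<^sup>2 - (b' * c') * r\<^sup>2)" .
  moreover have "e * e = 1" using e(1) by (metis abs_mult_self_eq mult_1)
  ultimately have eq: "(c' * p)\<^sup>2 - (a\<^sup>2 - 1) * r\<^sup>2 = (e * det P) * (c * c')"
    unfolding bc by (metis mult.assoc mult_1)
  have "\<bar>e * det P\<bar> = 1" using e(1) P(1) by (simp add: abs_mult)
  then consider "e * det P = 1" | "e * det P = -1" by linarith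
  then show ?thesis
  proof cases
    case 1
    then show ?thesis using pell_small_value_is_square[OF eq] small by simp
  next
    case 2
    then obtain z where "- (c * c') = z\<^sup>2" using pell_small_value_is_square[OF eq] small by auto
    then show ?thesis using small(1) zero_le_power2[of z] by linarith
  qed
qed


section \<open>Matrices that are conjugate modulo every integer\<close>

definition mat_cong :: "int \<Rightarrow> int^2^2 \<Rightarrow> int^2^2 \<Rightarrow> bool" where
  "mat_cong n X Y \<longleftrightarrow> (\<forall>i j. [X$i$j = Y$i$j] (mod n))"

lemma mat_cong_refl [simp]: "mat_cong n X X"
  and mat_cong_sym: "mat_cong n X Y \<Longrightarrow> mat_cong n Y X"
  and mat_cong_trans [trans]: "\<lbrakk>mat_cong n X Y; mat_cong n Y Z\<rbrakk> \<Longrightarrow> mat_cong n X Z"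
  by (auto simp: mat_cong_def cong_sym) (meson cong_trans)

lemma mat_cong_mult:
  assumes "mat_cong n X Y" "mat_cong n X' Y'"
  shows "mat_cong n (X ** X') (Y ** Y')"
  using assms by (auto simp: mat_cong_def matrix_mult_2 intro!: cong_add cong_mult)

text \<open>In a quotient of order n every n-th power is trivial, so \<open>N\<close> contains all
  \<open>(n *s w, 0)\<close>. Congruences modulo integers thereby control all finite quotients,
  without a classification of the subgroups of finite index.\<close>

lemma finite_index_subgroup_contains_multiples:
  assumes "det A = 1" and N: "N \<in> finite_index_normal_subgroups (semidirect A)"
  obtains n :: int where "n > 0"
    "\<And>X Y v k. mat_cong n X Y \<Longrightarrow> N #>\<^bsub>semidirect A\<^esub> (X *v v, k) = N #>\<^bsub>semidirect A\<^esub> (Y *v v, k)"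
proof -
  interpret A: group "semidirect A" by (rule group_semidirect[OF assms(1)])
  have nN: "N \<lhd> semidirect A" and fin: "finite (rcosets\<^bsub>semidirect A\<^esub> N)"
    using N by (auto simp: finite_index_normal_subgroups_def)
  interpret N: normal N "semidirect A" by (rule nN)
  have sub: "subgroup N (semidirect A)" by (rule normal_imp_subgroup[OF nN])
  interpret Q: group "semidirect A Mod N" by (rule N.factorgroup_is_group)
  let ?n = "order (semidirect A Mod N)"
  have "?n > 0"
    using fin by (simp add: order_def FactGroup_def card_gt_0_iff)
       (metis A.rcosetsI N.subset UNIV_I empty_iff semidirect_simps(1))
  moreover
  have pow: "N #>\<^bsub>semidirect A\<^esub> (x [^]\<^bsub>semidirect A\<^esub> (k::nat)) =
      (N #>\<^bsub>semidirect A\<^esub> x) [^]\<^bsub>semidirect A Mod N\<^esub> k" for x k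
  proof (induction k)
    case (Suc k)
    then show ?case using N.rcos_sum[of "x [^]\<^bsub>semidirect A\<^esub> k" x]
      by (simp add: FactGroup_def)
  qed (simp add: FactGroup_def A.coset_join2[OF _ sub N.one_closed, simplified])
  have mem: "(int ?n *s w, 0) \<in> N" for w
  proof -
    have "N #>\<^bsub>semidirect A\<^esub> (w, 0) \<in> carrier (semidirect A Mod N)"
      using A.rcosetsI[OF N.subset] by (simp add: FactGroup_def)
    then have "N #>\<^bsub>semidirect A\<^esub> ((w, 0) [^]\<^bsub>semidirect A\<^esub> ?n) = N"
      unfolding pow using Q.pow_order_eq_1 by (simp add: FactGroup_def)
    then show ?thesis
      using A.coset_join1[OF _ _ sub] by (simp add: semidirect_pow assms)
  qed
  have "N #>\<^bsub>semidirect A\<^esub> (X *v v, k) = N #>\<^bsub>semidirect A\<^esub> (Y *v v, k)"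
    if XY: "mat_cong (int ?n) X Y" for X Y v k
  proof -
    have neg: "M *v (- x) = - (M *v x)" for M :: "int^2^2" and x
      by (simp add: vec_eq_iff matrix_vector_mult_def sum_negf)
    define Z where "Z = (\<chi> i j. (X$i$j - Y$i$j) div int ?n)"
    have "(X - Y)$i$j = int ?n * Z$i$j" for i j
      using XY by (simp add: mat_cong_def Z_def cong_iff_dvd_diff)
    then have "X *v v - Y *v v = int ?n *s (Z *v v)"
      by (simp add: vec_eq_iff matrix_vector_mult_def sum_2 algebra_simps)
    then have "(X *v v - Y *v v, 0) \<in> N" using mem by metis
    \<comment> \<open>The powers of \<open>A\<close> from the product and from the inverse cancel,
      which leaves \<open>(X *v v - Y *v v, 0)\<close>.\<close>
    then have "(X *v v, k) \<otimes>\<^bsub>semidirect A\<^esub> inv\<^bsub>semidirect A\<^esub> (Y *v v, k) \<in> N"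
      by (simp add: semidirect_inv assms neg matrix_vector_mul_assoc matrix_mul_assoc mat_pow_cancel)
    then show ?thesis using A.rcos_eq_iff[OF sub] by simp
  qed
  ultimately show ?thesis using that[of "int ?n"] by simp
qed

text \<open>Exact intertwining makes every \<open>P k\<close> and \<open>Q k\<close> a homomorphism.
  That they are eventually inverse to each other modulo each n is enough, since a finite quotient
  sees the lattice only modulo some n.\<close>

lemma isomorphic_profinite_completions_semidirect:
  fixes P Q :: "nat \<Rightarrow> int^2^2"
  assumes A: "det A = 1" and B: "det B = 1"
    and PA: "\<And>k. P k ** A = B ** P k" and QB: "\<And>k. Q k ** B = A ** Q k"
    and conv: "\<And>n. n > 0 \<Longrightarrow> \<exists>K. \<forall>k\<ge>K. mat_cong n (P k) (P K) \<and>
      mat_cong n (Q k ** P k) (mat 1) \<and> mat_cong n (P k ** Q k) (mat 1)"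
  shows "isomorphic_profinite_completions (semidirect A) (semidirect B)"
proof -
  interpret A: group "semidirect A" by (rule group_semidirect[OF A])
  interpret B: group "semidirect B" by (rule group_semidirect[OF B])
  have convQ: "\<exists>K. \<forall>k\<ge>K. mat_cong n (Q k) (Q K)" if n: "n > 0" for n
  proof -
    obtain K where K: "\<And>k. k \<ge> K \<Longrightarrow> mat_cong n (P k) (P K)"
      "\<And>k. k \<ge> K \<Longrightarrow> mat_cong n (Q k ** P k) (mat 1)"
      "\<And>k. k \<ge> K \<Longrightarrow> mat_cong n (P k ** Q k) (mat 1)"
      using conv[OF n] by blast
    have "mat_cong n (Q k) (Q K)" if k: "k \<ge> K" for k
    proof -
      \<comment> \<open>Convergence of \<open>P\<close> passes to its approximate inverses:
        \<open>P K\<close> is exchanged for \<open>P k\<close> between \<open>Q k\<close> and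
        \<open>Q K\<close>.\<close>
      have "mat_cong n (Q k ** mat 1) (Q k ** (P K ** Q K))"
        by (intro mat_cong_mult mat_cong_refl mat_cong_sym[OF K(3)[OF order_refl]])
      also have "mat_cong n (Q k ** (P K ** Q K)) (Q k ** (P k ** Q K))"
        by (intro mat_cong_mult mat_cong_refl mat_cong_sym[OF K(1)] k)
      also have "mat_cong n (Q k ** (P k ** Q K)) (mat 1 ** Q K)"
        unfolding matrix_mul_assoc by (intro mat_cong_mult mat_cong_refl K(2) k)
      finally show ?thesis by simp
    qed
    then show ?thesis by blast
  qed
  define f g where "f = (\<lambda>k (v, i :: int). (P k *v v, i))" and "g = (\<lambda>k (v, i :: int). (Q k *v v, i))"
  show ?thesis
  proof (rule isomorphic_profinite_completionsI)
    show "convergent_homs (semidirect A) (semidirect B) f"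
    proof unfold_locales
      show "f k \<in> hom (semidirect A) (semidirect B)" for k
        unfolding f_def by (rule semidirect_hom[OF A B PA])
      fix M assume "M \<in> finite_index_normal_subgroups (semidirect B)"
      then obtain n where n: "n > 0" "\<And>X Y v k. mat_cong n X Y \<Longrightarrow>
          M #>\<^bsub>semidirect B\<^esub> (X *v v, k) = M #>\<^bsub>semidirect B\<^esub> (Y *v v, k)"
        using finite_index_subgroup_contains_multiples[OF B] by metis
      obtain K where "\<And>k. k \<ge> K \<Longrightarrow> mat_cong n (P k) (P K)" using conv[OF n(1)] by blast
      then show "\<exists>K. \<forall>k\<ge>K. \<forall>x\<in>carrier (semidirect A).
          M #>\<^bsub>semidirect B\<^esub> f k x = M #>\<^bsub>semidirect B\<^esub> f K x"
        unfolding f_def using n(2) by (intro exI[of _ K]) auto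
    qed
    show "convergent_homs (semidirect B) (semidirect A) g"
    proof unfold_locales
      show "g k \<in> hom (semidirect B) (semidirect A)" for k
        unfolding g_def by (rule semidirect_hom[OF B A QB])
      fix M assume "M \<in> finite_index_normal_subgroups (semidirect A)"
      then obtain n where n: "n > 0" "\<And>X Y v k. mat_cong n X Y \<Longrightarrow>
          M #>\<^bsub>semidirect A\<^esub> (X *v v, k) = M #>\<^bsub>semidirect A\<^esub> (Y *v v, k)"
        using finite_index_subgroup_contains_multiples[OF A] by metis
      obtain K where "\<And>k. k \<ge> K \<Longrightarrow> mat_cong n (Q k) (Q K)" using convQ[OF n(1)] by blast
      then show "\<exists>K. \<forall>k\<ge>K. \<forall>x\<in>carrier (semidirect B).
          M #>\<^bsub>semidirect A\<^esub> g k x = M #>\<^bsub>semidirect A\<^esub> g K x"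
        unfolding g_def using n(2) by (intro exI[of _ K]) auto
    qed
    have gf: "g k (f k x) = ((Q k ** P k) *v fst x, snd x)" "f k (g k x) = ((P k ** Q k) *v fst x, snd x)" for k x
      by (simp_all add: f_def g_def case_prod_beta matrix_vector_mul_assoc)
    show "\<exists>K. \<forall>k\<ge>K. \<forall>x\<in>carrier (semidirect A). N #>\<^bsub>semidirect A\<^esub> g k (f k x) = N #>\<^bsub>semidirect A\<^esub> x"
      if N: "N \<in> finite_index_normal_subgroups (semidirect A)" for N
    proof -
      obtain n where n: "n > 0" "\<And>X Y v k. mat_cong n X Y \<Longrightarrow>
          N #>\<^bsub>semidirect A\<^esub> (X *v v, k) = N #>\<^bsub>semidirect A\<^esub> (Y *v v, k)"
        using finite_index_subgroup_contains_multiples[OF A N] by metis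
      obtain K where "\<And>k. k \<ge> K \<Longrightarrow> mat_cong n (Q k ** P k) (mat 1)" using conv[OF n(1)] by blast
      then show ?thesis
        unfolding gf(1) using n(2)[of _ "mat 1"] by (intro exI[of _ K]) auto
    qed
    show "\<exists>K. \<forall>k\<ge>K. \<forall>x\<in>carrier (semidirect B). N #>\<^bsub>semidirect B\<^esub> f k (g k x) = N #>\<^bsub>semidirect B\<^esub> x"
      if N: "N \<in> finite_index_normal_subgroups (semidirect B)" for N
    proof -
      obtain n where n: "n > 0" "\<And>X Y v k. mat_cong n X Y \<Longrightarrow>
          N #>\<^bsub>semidirect B\<^esub> (X *v v, k) = N #>\<^bsub>semidirect B\<^esub> (Y *v v, k)"
        using finite_index_subgroup_contains_multiples[OF B N] by metis
      obtain K where "\<And>k. k \<ge> K \<Longrightarrow> mat_cong n (P k ** Q k) (mat 1)" using conv[OF n(1)] by blast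
      then show ?thesis
        unfolding gf(2) using n(2)[of _ "mat 1"] by (intro exI[of _ K]) auto
    qed
  qed
qed

text \<open>By the pigeonhole principle on the exponents from 0 to n, the powers of \<open>c\<close>
  modulo n become periodic, with preperiod \<open>i\<close> and period \<open>d\<close> at most n.
  For k \<ge> n both k! and 2 k! are multiples of \<open>d\<close> and at least \<open>i\<close>.
  The threshold is the same for all \<open>c\<close>, coprime to n or not.\<close>

lemma power_fact_stable:
  fixes c n :: int
  assumes n: "n > 0" and k: "k \<ge> nat n"
  shows "[c ^ fact k = c ^ fact (nat n)] (mod n)" "[c ^ (2 * fact k) = c ^ fact k] (mod n)"
proof -
  have "\<not> inj_on (\<lambda>i. c ^ i mod n) {0..nat n}"
  proof
    assume "inj_on (\<lambda>i. c ^ i mod n) {0..nat n}"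
    moreover have "(\<lambda>i. c ^ i mod n) ` {0..nat n} \<subseteq> {0..<n}" using n by auto
    ultimately have "card {0..nat n} \<le> card {0..<n}" by (rule card_inj_on_le) simp
    then show False using n by simp
  qed
  then obtain i j where "i \<in> {0..nat n}" "j \<in> {0..nat n}" "i < j" "c ^ i mod n = c ^ j mod n"
    unfolding inj_on_def by (metis nat_neq_iff)
  then obtain d where d: "0 < d" "d \<le> nat n" "i \<le> nat n" and c: "[c ^ (i + d) = c ^ i] (mod n)"
    by (metis (mono_tags) atLeastAtMost_iff cong_def diff_le_self le_add_diff_inverse le_trans
        less_imp_le_nat zero_less_diff)
  have per: "[c ^ (i + m + d * l) = c ^ (i + m)] (mod n)" for m l
  proof (induction l)
    case (Suc l)
    have "[c ^ (i + d) * c ^ (m + d * l) = c ^ i * c ^ (m + d * l)] (mod n)"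
      by (intro cong_mult c cong_refl)
    then have "[c ^ (i + m + d * Suc l) = c ^ (i + m + d * l)] (mod n)"
      by (simp add: power_add mult_ac)
    then show ?case using Suc cong_trans by blast
  qed simp
  have cong: "[c ^ x = c ^ y] (mod n)" if "y \<le> x" "d dvd x" "d dvd y" "i \<le> y" for x y
  proof -
    have "d dvd x - y" using that by (intro dvd_diff_nat)
    then obtain l where "x - y = d * l" by (elim dvdE)
    then have "x = i + (y - i) + d * l" using that by simp
    then show ?thesis using per[of "y - i" l] that by simp
  qed
  have dv: "d dvd fact k" if "k \<ge> nat n" for k using d that by (intro dvd_fact) auto
  have le: "i \<le> fact k" if "k \<ge> nat n" for k using d that fact_ge_self le_trans by blast
  show "[c ^ fact k = c ^ fact (nat n)] (mod n)"
    using k dv le by (intro cong fact_mono_nat) auto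
  show "[c ^ (2 * fact k) = c ^ fact k] (mod n)"
    using dv[OF k] le[OF k] by (intro cong) auto
qed

text \<open>The power is idempotent by \<open>power_fact_stable\<close>, and an idempotent unit is
  1. The uniform threshold allows a base that varies with \<open>k\<close>, such as a determinant
  \<open>det (P k)\<close>.\<close>

lemma coprime_power_fact:
  fixes c n :: int
  assumes "n > 0" "k \<ge> nat n" "coprime c n"
  shows "[c ^ fact k = 1] (mod n)"
proof -
  have "[c ^ fact k * c ^ fact k = c ^ fact k * 1] (mod n)"
    using power_fact_stable(2)[OF assms(1,2), of c] by (simp add: power_add[symmetric] mult_2)
  then show ?thesis using cong_mult_lcancel[of "c ^ fact k" n "c ^ fact k" 1] assms(3) by simp
qed

text \<open>
  The sequence \<open>s k = c ^ k!\<close> tends to 1 in the \<open>p\<close>-adic integers for \<open>p\<close> prime to \<open>c\<close>, and to 0 for \<open>p\<close>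
  dividing \<open>c\<close>.  The matrix \<open>P k\<close> below conjugates one matrix to the other over the rationals, and its
  determinant \<open>c s\<^sup>2 - b (1 - s)\<^sup>2\<close> is therefore eventually prime to any given integer.
\<close>

lemma mat_abc_isomorphic_profinite_completions:
  fixes a b c :: int
  assumes bc: "b * c = a\<^sup>2 - 1" and "coprime b c"
  shows "isomorphic_profinite_completions (semidirect (mat_abc a b c)) (semidirect (mat_abc a (a\<^sup>2 - 1) 1))"
proof -
  define s where "s k = c ^ fact k" for k
  \<comment> \<open>Both ((c, 0), (0, 1)) and ((0, b), (1, 0)) intertwine the two matrices, with
    determinants c and -b. \<open>P k\<close> combines them with weights \<open>s k\<close> and
    \<open>1 - s k\<close>: the first prevails at the primes where \<open>s k\<close> tends to 1,
    the second where it tends to 0, each time with a unit determinant.\<close>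
  define P :: "nat \<Rightarrow> int^2^2" where
    "P k = vector [vector [c * s k, b * (1 - s k)], vector [1 - s k, s k]]" for k
  \<comment> \<open>A substitute for the inverse matrix: modulo n the reciprocal of the determinant
    eventually equals its power with exponent k! - 1.\<close>
  define Q where "Q k = (\<chi> i j. det (P k) ^ (fact k - 1) * adj2 (P k) $ i $ j)" for k
  have PA: "P k ** mat_abc a b c = mat_abc a (a\<^sup>2 - 1) 1 ** P k" for k
    by (simp add: vec_eq_iff forall_2 matrix_mult_2 P_def bc[symmetric] algebra_simps)
  have detP: "det (P k) = c * (s k)\<^sup>2 - b * (1 - s k)\<^sup>2" for k
    by (simp add: P_def det_2 power2_eq_square)
  have QB: "Q k ** mat_abc a (a\<^sup>2 - 1) 1 = mat_abc a b c ** Q k" for k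
    by (simp add: vec_eq_iff forall_2 matrix_mult_2 P_def Q_def adj2_def bc[symmetric] algebra_simps)
  have fact: "x ^ (fact k - Suc 0) * x = x ^ fact k" for x :: int and k
    using power_minus_mult[of "fact k" x] by (simp add: mult.commute)
  have QP: "Q k ** P k = mat (det (P k) ^ fact k)" "P k ** Q k = mat (det (P k) ^ fact k)" for k
    unfolding fact[symmetric]
    by (simp_all add: vec_eq_iff forall_2 matrix_mult_2 Q_def adj2_def det_2 mat_def algebra_simps)
  show ?thesis
  proof (rule isomorphic_profinite_completions_semidirect[OF _ _ PA QB])
    show "det (mat_abc a b c) = 1" "det (mat_abc a (a\<^sup>2 - 1) 1) = 1"
      using bc by (simp_all add: det_mat_abc)
    fix n :: int assume n: "n > 0"
    have "mat_cong n (P k) (P (nat n))" if "k \<ge> nat n" for k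
      using power_fact_stable(1)[OF n that, of c]
      by (auto simp: mat_cong_def forall_2 P_def s_def intro!: cong_mult cong_diff)
    moreover have "[det (P k) ^ fact k = 1] (mod n)" if k: "k \<ge> nat n" for k
    proof (rule coprime_power_fact[OF n k])
      show "coprime (det (P k)) n"
      proof (rule ccontr)
        assume "\<not> coprime (det (P k)) n"
        then obtain p where p: "prime p" "p dvd det (P k)" "p dvd n"
          using prime_divisor_exists[of "gcd (det (P k)) n"] n
          by (auto simp: coprime_iff_gcd_eq_1 is_unit_gcd)
        \<comment> \<open>\<open>s k\<close> is idempotent modulo n, hence 0 or 1 modulo each prime
          factor of n, where \<open>det (P k)\<close> becomes -b or c accordingly.\<close>
        have "n dvd (s k)\<^sup>2 - s k"
          using power_fact_stable(2)[OF n k, of c]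
          by (simp add: s_def cong_iff_dvd_diff power_mult[symmetric] mult.commute)
        then have "p dvd s k * (s k - 1)"
          using dvd_trans[OF p(3)] by (simp add: power2_eq_square algebra_simps)
        then consider "p dvd s k" | "p dvd s k - 1" using p(1) prime_dvd_mult_iff by blast
        then show False
        proof cases
          case 1
          then have "p dvd c" using p(1) prime_dvd_power by (auto simp: s_def)
          have "p dvd c * (s k)\<^sup>2 - det (P k)" using p \<open>p dvd c\<close> by auto
          then have "p dvd b * (1 - s k)\<^sup>2" by (simp add: detP)
          then have "p dvd b \<or> p dvd 1 - s k" using p(1) prime_dvd_mult_iff prime_dvd_power by blast
          moreover have "\<not> p dvd 1 - s k"
          proof
            assume "p dvd 1 - s k"
            then have "p dvd (1 - s k) + s k" using 1 dvd_add by blast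
            then show False using p(1) not_prime_unit by force
          qed
          ultimately show False using \<open>p dvd c\<close> assms(2) p(1) not_coprimeI not_prime_unit by blast
        next
          case 2
          then have "p dvd (1 - s k)" by (metis dvd_minus_iff minus_diff_eq)
          then have "p dvd b * (1 - s k)\<^sup>2 + det (P k)" using p by (simp add: power2_eq_square)
          then have "p dvd c * (s k)\<^sup>2" by (simp add: detP)
          then have "p dvd c \<or> p dvd s k" using p(1) prime_dvd_mult_iff prime_dvd_power by blast
          then have "p dvd s k" unfolding s_def by (auto intro: dvd_power_le dvd_trans[OF _ dvd_power])
          then have "p dvd (1 - s k) + s k" using \<open>p dvd 1 - s k\<close> dvd_add by blast
          then show False using p(1) not_prime_unit by force
        qed
      qed
    qed
    then have "mat_cong n (mat (det (P k) ^ fact k)) (mat 1)" if "k \<ge> nat n" for k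
      using that by (simp add: mat_cong_def mat_def)
    ultimately show "\<exists>K. \<forall>k\<ge>K. mat_cong n (P k) (P K) \<and>
        mat_cong n (Q k ** P k) (mat 1) \<and> mat_cong n (P k ** Q k) (mat 1)"
      unfolding QP by blast
  qed
qed


section \<open>Covering spaces given by group actions\<close>

text \<open>\<open>range F\<close> with its subspace topology is to represent the orbit space:
  \<open>F\<close> separates precisely the orbits, and \<open>cocompact\<close> makes the subspace
  topology the quotient topology. Freeness of the action is part of
  \<open>act_wandering\<close>.\<close>

locale deck_action = group D for D :: "('g, 'm) monoid_scheme" (structure) +
  fixes act :: "'g \<Rightarrow> 'e::real_normed_vector \<Rightarrow> 'e" and F :: "'e \<Rightarrow> 'b::real_normed_vector"
  assumes act_one: "act \<one> x = x"
    and act_mult: "\<lbrakk>g \<in> carrier D; g' \<in> carrier D\<rbrakk> \<Longrightarrow> act (g \<otimes> g') x = act g (act g' x)"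
    and act_continuous: "g \<in> carrier D \<Longrightarrow> continuous_on UNIV (act g)"
    and act_wandering: "\<exists>U. open U \<and> x \<in> U \<and> (\<forall>g\<in>carrier D. \<forall>y\<in>U. act g y \<in> U \<longrightarrow> g = \<one>)"
    and F_continuous: "continuous_on UNIV F"
    and F_eq_iff: "F x = F y \<longleftrightarrow> (\<exists>g\<in>carrier D. y = act g x)"
    and cocompact: "\<exists>K. compact K \<and> F ` K = range F"
begin

lemma act_inv: "g \<in> carrier D \<Longrightarrow> act (inv g) (act g x) = x" "g \<in> carrier D \<Longrightarrow> act g (act (inv g) x) = x"
  using act_mult[of "inv g" g x] act_mult[of g "inv g" x] by (auto simp: act_one)

lemma act_eq_iff:
  assumes "g \<in> carrier D" "g' \<in> carrier D"
  shows "act g x = act g' x \<longleftrightarrow> g = g'"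
proof
  assume eq: "act g x = act g' x"
  obtain U where U: "x \<in> U" "\<forall>g\<in>carrier D. \<forall>y\<in>U. act g y \<in> U \<longrightarrow> g = \<one>" using act_wandering[of x] by blast
  have "act (inv g' \<otimes> g) x = x" using assms eq act_inv by (simp add: act_mult)
  then have "inv g' \<otimes> g = \<one>" using U assms by (metis inv_closed m_closed)
  then show "g = g'" using assms by (metis inv_closed inv_equality inv_inv)
qed simp

lemma F_act [simp]: "g \<in> carrier D \<Longrightarrow> F (act g x) = F x"
  using F_eq_iff[of x "act g x"] by auto

lemma act_image_eq_vimage: "g \<in> carrier D \<Longrightarrow> act g ` U = act (inv g) -` U"
  using act_inv by (auto intro: image_eqI[where x = "act (inv g) _"])

lemma open_act_image:
  assumes "g \<in> carrier D" "open U"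
  shows "open (act g ` U)"
  using assms act_continuous[of "inv g"] by (simp add: act_image_eq_vimage open_vimage)

lemma image_diff_vimage: "f ` (A - f -` B) = f ` A - B"
  by auto

lemma vimage_F_image: "F -` (F ` U) = (\<Union>g\<in>carrier D. act g ` U)"
proof -
  have "x \<in> F -` (F ` U) \<longleftrightarrow> (\<exists>u\<in>U. \<exists>g\<in>carrier D. x = act g u)" for x
    using F_eq_iff[of _ x] by (auto simp: image_iff) metis
  then show ?thesis by blast
qed

text \<open>The saturation of \<open>U\<close> is open, being a union of translates. Removing it
  from \<open>K\<close> leaves a compact set, whose image is closed and is the complement of the
  image of \<open>U\<close>.\<close>

lemma F_open_map:
  assumes "open U"
  shows "openin (top_of_set (range F)) (F ` U)"
proof -
  obtain K where K: "compact K" "F ` K = range F" using cocompact by blast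
  have "open (F -` (F ` U))"
    unfolding vimage_F_image using open_act_image assms by blast
  then have "compact (K - F -` (F ` U))" using K by (intro compact_diff)
  then have "compact (F ` (K - F -` (F ` U)))"
    using F_continuous by (metis compact_continuous_image continuous_on_subset subset_UNIV)
  moreover have "range F - F ` U = F ` (K - F -` (F ` U))"
    using image_diff_vimage[of F K "F ` U"] by (simp add: K(2))
  ultimately have "closedin (top_of_set (range F)) (range F - F ` U)"
    by (metis Diff_subset closed_subset compact_imp_closed)
  then show ?thesis by (simp add: openin_closedin_eq image_mono)
qed

theorem covering_space_F: "covering_space UNIV F (range F)"
proof
  show "continuous_on UNIV F" by (rule F_continuous)
  fix z assume "z \<in> range F"
  then obtain x where x: "z = F x" by blast
  obtain U where U: "open U" "x \<in> U" "\<And>g y. \<lbrakk>g \<in> carrier D; y \<in> U; act g y \<in> U\<rbrakk> \<Longrightarrow> g = \<one>"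
    using act_wandering[of x] by blast
  let ?v = "(\<lambda>g. act g ` U) ` carrier D"
  have "disjnt (act g ` U) (act g' ` U)"
    if g: "g \<in> carrier D" "g' \<in> carrier D" and ne: "act g ` U \<noteq> act g' ` U" for g g'
  proof (rule ccontr)
    assume "\<not> disjnt (act g ` U) (act g' ` U)"
    then obtain y y' where y: "y \<in> U" "y' \<in> U" "act g y = act g' y'" by (auto simp: disjnt_def)
    then have "act (inv g' \<otimes> g) y \<in> U" using g act_inv by (simp add: act_mult)
    then have "inv g' \<otimes> g = \<one>" using U(3) y g by (metis inv_closed m_closed)
    then have "g = g'" using g by (metis inv_closed inv_equality inv_inv)
    then show False using ne by simp
  qed
  then have "pairwise disjnt ?v" by (auto simp: pairwise_def)
  moreover have "\<exists>q. homeomorphism (act g ` U) (F ` U) F q" if g: "g \<in> carrier D" for g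
  proof (rule homeomorphism_injective_open_map)
    show "continuous_on (act g ` U) F" using F_continuous continuous_on_subset by blast
    show "F ` act g ` U = F ` U" using g by (simp add: image_image)
    show "inj_on F (act g ` U)"
    proof (rule inj_onI)
      fix y y' assume y: "y \<in> act g ` U" "y' \<in> act g ` U" "F y = F y'"
      then obtain u u' where u: "u \<in> U" "u' \<in> U" "y = act g u" "y' = act g u'" by blast
      then obtain k where k: "k \<in> carrier D" "u' = act k u" using y(3) g by (auto simp: F_eq_iff)
      then have "k = \<one>" using U(3) u by blast
      then show "y = y'" using k u by (simp add: act_one)
    qed
    show "openin (top_of_set (F ` U)) (F ` W)" if "openin (top_of_set (act g ` U)) W" for W
    proof -
      have "open W" using that open_act_image[OF g U(1)] openin_open_trans by (metis openin_open_eq)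
      moreover have "F ` W \<subseteq> F ` U" 
        using image_mono[OF openin_imp_subset[OF that], of F] g by (simp add: image_image)
      ultimately show ?thesis using F_open_map by (meson image_mono openin_subset_trans subset_UNIV)
    qed
  qed blast
  ultimately show "\<exists>T. z \<in> T \<and> openin (top_of_set (range F)) T \<and>
      (\<exists>v. \<Union>v = UNIV \<inter> F -` T \<and> (\<forall>u\<in>v. openin (top_of_set UNIV) u) \<and>
        pairwise disjnt v \<and> (\<forall>u\<in>v. \<exists>q. homeomorphism u T F q))"
    using x U F_open_map[OF U(1)] open_act_image[OF _ U(1)] vimage_F_image[of U]
    by (intro exI[of _ "F ` U"] conjI exI[of _ ?v]) auto
qed simp

end


section \<open>The fundamental group of an orbit space\<close>

locale orbit_space = deck_action D act F
  for D :: "('g, 'm) monoid_scheme" (structure)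
    and act :: "'g \<Rightarrow> 'e::real_normed_vector \<Rightarrow> 'e" and F :: "'e \<Rightarrow> 'b::real_normed_vector" +
  fixes X :: "'x topology" and h h' and e0 :: 'e
  assumes homeo: "homeomorphic_maps X (top_of_set (range F)) h h'"
begin

definition proj :: "'e \<Rightarrow> 'x" where "proj e = h' (F e)"

text \<open>A relation and not an endpoint function, since the existence of \<open>g\<close> rests
  on path lifting and its uniqueness on monodromy. The homotopy classes of loops will be the sets
  \<open>{p. lifts_to p g}\<close>.\<close>

definition lifts_to :: "(real \<Rightarrow> 'x) \<Rightarrow> 'g \<Rightarrow> bool" where
  "lifts_to p g \<longleftrightarrow> g \<in> carrier D \<and> (\<exists>k. continuous_on {0..1} k \<and> k 0 = e0 \<and> k 1 = act g e0 \<and>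
     (\<forall>t\<in>{0..1}. proj (k t) = p t))"

abbreviation "base \<equiv> proj e0"

lemma proj_continuous: "continuous_map euclidean X proj"
proof -
  have "continuous_map euclidean (top_of_set (range F)) F"
    using F_continuous by (simp add: continuous_map_in_subtopology)
  then have "continuous_map euclidean X (h' \<circ> F)"
    using homeo continuous_map_compose unfolding homeomorphic_maps_def by blast
  moreover have "h' \<circ> F = proj" by (simp add: fun_eq_iff proj_def)
  ultimately show ?thesis by simp
qed

lemma h_proj: "h (proj e) = F e"
  using homeo by (simp add: homeomorphic_maps_def proj_def)

lemma proj_act: "g \<in> carrier D \<Longrightarrow> proj (act g e) = proj e"
  by (simp add: proj_def)

lemma pathin_proj:
  assumes "continuous_on {0..1} k"
  shows "pathin X (\<lambda>t. proj (k t))"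
proof -
  have "continuous_map (top_of_set {0..1}) euclidean k" using assms by simp
  from continuous_map_compose[OF this proj_continuous] show ?thesis by (simp add: pathin_def o_def)
qed

lemma lifts_to_imp_loop:
  assumes "lifts_to p g"
  shows "p \<in> loops_at X base"
proof -
  obtain k where k: "continuous_on {0..1} k" "k 0 = e0" "k 1 = act g e0" "\<forall>t\<in>{0..1}. proj (k t) = p t"
    using assms by (auto simp: lifts_to_def)
  have "pathin X p"
    using continuous_map_eq[OF pathin_proj[OF k(1), unfolded pathin_def], of p] k(4)
    by (simp add: pathin_def)
  moreover have "p 0 = base" "p 1 = base"
    using k(2,3) k(4)[rule_format, of 0] k(4)[rule_format, of 1] assms
    by (auto simp: lifts_to_def proj_act)
  ultimately show ?thesis by (simp add: loops_at_def)
qed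

lemma loop_imp_lifts_to:
  assumes "p \<in> loops_at X base"
  obtains g where "lifts_to p g"
proof -
  have p: "pathin X p" "p 0 = base" "p 1 = base" using assms by (auto simp: loops_at_def)
  have hc: "continuous_map X (top_of_set (range F)) h" using homeo by (simp add: homeomorphic_maps_def)
  have "path (h \<circ> p)" "path_image (h \<circ> p) \<subseteq> range F"
    using continuous_map_compose[OF p(1)[unfolded pathin_def] hc]
    by (auto simp: path_def path_image_def continuous_map_in_subtopology Pi_iff)
  moreover have "pathstart (h \<circ> p) = F e0" by (simp add: pathstart_def p h_proj)
  ultimately obtain k where k: "path k" "pathstart k = e0" "\<And>t. t \<in> {0..1} \<Longrightarrow> F (k t) = (h \<circ> p) t"
    using covering_space_lift_path_strong[OF covering_space_F UNIV_I] by blast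
  have "F e0 = F (k 1)" using k(3)[of 1] by (simp add: p h_proj)
  then obtain g where g: "g \<in> carrier D" "k 1 = act g e0" by (auto simp: F_eq_iff)
  have "p t \<in> topspace X" if "t \<in> {0..1}" for t
    using p(1) that by (force simp: pathin_def continuous_map_def)
  then have "proj (k t) = p t" if "t \<in> {0..1}" for t
    using k(3)[OF that] homeo that by (simp add: proj_def homeomorphic_maps_def)
  then have "lifts_to p g"
    unfolding lifts_to_def using k g by (auto simp: path_def pathstart_def intro!: exI[of _ k])
  then show ?thesis by (rule that)
qed

text \<open>The total space is a vector space: the segments between two lifts with the same ends
  form a homotopy with fixed ends, which \<open>proj\<close> carries to \<open>X\<close>.\<close>

lemma lifts_to_same_imp_homotopic:
  assumes "lifts_to p g" "lifts_to p' g"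
  shows "(p, p') \<in> loop_homotopy_rel X base"
proof -
  obtain k where k: "continuous_on {0..1} k" "k 0 = e0" "k 1 = act g e0" "\<And>t. t\<in>{0..1} \<Longrightarrow> proj (k t) = p t"
    using assms by (auto simp: lifts_to_def)
  obtain k' where k': "continuous_on {0..1} k'" "k' 0 = e0" "k' 1 = act g e0" "\<And>t. t\<in>{0..1} \<Longrightarrow> proj (k' t) = p' t"
    using assms by (auto simp: lifts_to_def)
  have g: "g \<in> carrier D" using assms by (simp add: lifts_to_def)
  define H where "H = (\<lambda>(s, t). (1 - s) *\<^sub>R k t + s *\<^sub>R k' t)"
  have "continuous_on ({0..1} \<times> {0..1}) H"
    unfolding H_def case_prod_beta
    by (intro continuous_intros continuous_on_compose2[OF k(1)] continuous_on_compose2[OF k'(1)]) auto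
  then have "continuous_map (prod_topology (top_of_set {0..1}) (top_of_set {0..1})) euclidean H"
    by (simp flip: subtopology_Times)
  from continuous_map_compose[OF this proj_continuous]
  have "homotopic_with (\<lambda>r. r 0 = base \<and> r 1 = base) (top_of_set {0..1}) X
      (\<lambda>t. proj (k t)) (\<lambda>t. proj (k' t))"
    unfolding homotopic_with_def
    by (intro exI[of _ "proj \<circ> H"])
       (auto simp: H_def k k' g proj_act simp flip: scaleR_add_left)
  then have "homotopic_with (\<lambda>r. r 0 = base \<and> r 1 = base) (top_of_set {0..1}) X p p'"
    by (rule homotopic_with_eq) (auto simp: k k')
  then show ?thesis
    using assms lifts_to_imp_loop by (auto simp: loop_homotopy_rel_def)
qed

text \<open>Monodromy, applied in \<open>range F\<close> after transport by \<open>h\<close>, gives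
  both lifts the same end, and freeness of the action determines the group element from it.\<close>

lemma homotopic_imp_lifts_to_same:
  assumes "(p, p') \<in> loop_homotopy_rel X base" "lifts_to p g" "lifts_to p' g'"
  shows "g = g'"
proof -
  obtain k where k: "continuous_on {0..1} k" "k 0 = e0" "k 1 = act g e0" "\<And>t. t\<in>{0..1} \<Longrightarrow> proj (k t) = p t"
    using assms by (auto simp: lifts_to_def)
  obtain k' where k': "continuous_on {0..1} k'" "k' 0 = e0" "k' 1 = act g' e0" "\<And>t. t\<in>{0..1} \<Longrightarrow> proj (k' t) = p' t"
    using assms by (auto simp: lifts_to_def)
  have hc: "continuous_map X (top_of_set (range F)) h" using homeo by (simp add: homeomorphic_maps_def)
  have pp: "p \<in> loops_at X base"
    and hom: "homotopic_with (\<lambda>r. r 0 = base \<and> r 1 = base) (top_of_set {0..1}) X p p'"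
    using assms(1) by (auto simp: loop_homotopy_rel_def)
  have "homotopic_with (\<lambda>r. r 0 = h base \<and> r 1 = h base) (top_of_set {0..1}) (top_of_set (range F)) (h \<circ> p) (h \<circ> p')"
    by (rule homotopic_with_compose_continuous_map_left[OF hom hc]) auto
  then have hp: "homotopic_paths (range F) (h \<circ> p) (h \<circ> p')"
    using pp by (simp add: homotopic_paths_def pathstart_def pathfinish_def loops_at_def)
  have "pathfinish k = pathfinish k'"
  proof (rule covering_space_monodromy[OF covering_space_F _ _ _ _ hp])
    show "F (k t) = (h \<circ> p) t" "F (k' t) = (h \<circ> p') t" if "t \<in> {0..1}" for t
      using k(4)[OF that] k'(4)[OF that] by (simp_all flip: h_proj)
  qed (use k k' homotopic_paths_imp_path[OF hp] homotopic_paths_imp_subset[OF hp] in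
      \<open>auto simp: path_def pathstart_def\<close>)
  then show ?thesis
    using k k' assms act_eq_iff by (auto simp: pathfinish_def lifts_to_def)
qed

lemma lifts_to_linepath:
  assumes "g \<in> carrier D"
  shows "lifts_to (\<lambda>t. proj (linepath e0 (act g e0) t)) g"
  unfolding lifts_to_def using assms
  by (intro conjI exI[of _ "linepath e0 (act g e0)"]) (auto simp: linepath_0' linepath_1' continuous_on_linepath)

text \<open>The second lift is moved by \<open>g\<close> so as to start where the first one ends; it
  then ends at \<open>act g (act g' e0)\<close>, which fixes the order of the product.\<close>

lemma lifts_to_concat:
  assumes "lifts_to p g" "lifts_to p' g'"
  shows "lifts_to (loop_concat p p') (g \<otimes> g')"
proof -
  obtain k where k: "continuous_on {0..1} k" "k 0 = e0" "k 1 = act g e0" "\<And>t. t\<in>{0..1} \<Longrightarrow> proj (k t) = p t"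
    using assms by (auto simp: lifts_to_def)
  obtain k' where k': "continuous_on {0..1} k'" "k' 0 = e0" "k' 1 = act g' e0" "\<And>t. t\<in>{0..1} \<Longrightarrow> proj (k' t) = p' t"
    using assms by (auto simp: lifts_to_def)
  have g: "g \<in> carrier D" "g' \<in> carrier D" using assms by (auto simp: lifts_to_def)
  have "path (k +++ (act g \<circ> k'))"
  proof (rule path_join_imp)
    show "path k" "pathfinish k = pathstart (act g \<circ> k')"
      using k k' by (auto simp: path_def pathfinish_def pathstart_def)
    show "path (act g \<circ> k')"
      unfolding path_def by (intro continuous_on_compose k' continuous_on_subset[OF act_continuous[OF g(1)]]) auto
  qed
  then show ?thesis
    unfolding lifts_to_def using g k k'
    by (intro conjI exI[of _ "k +++ (act g \<circ> k')"])
       (auto simp: path_def joinpaths_def loop_concat_def proj_act act_mult)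
qed

lemma homotopy_class_eq:
  assumes "lifts_to p g"
  shows "loop_homotopy_rel X base `` {p} = {p'. lifts_to p' g}"
proof -
  have "lifts_to p' g" if p': "(p, p') \<in> loop_homotopy_rel X base" for p'
  proof -
    have "p' \<in> loops_at X base" using p' by (simp add: loop_homotopy_rel_def)
    then obtain g' where "lifts_to p' g'" by (rule loop_imp_lifts_to)
    then show ?thesis using homotopic_imp_lifts_to_same[OF p' assms] by blast
  qed
  then show ?thesis using lifts_to_same_imp_homotopic[OF assms] by blast
qed

theorem deck_iso_fundamental_group:
  "(\<lambda>g. {p. lifts_to p g}) \<in> iso D (fundamental_group X base)"
  "{p. lifts_to p \<one>} = \<one>\<^bsub>fundamental_group X base\<^esub>"
proof -
  let ?\<Theta> = "\<lambda>g. {p. lifts_to p g}"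
  have ne: "\<exists>p. lifts_to p g" if "g \<in> carrier D" for g using lifts_to_linepath[OF that] by blast
  have carr: "carrier (fundamental_group X base) = ?\<Theta> ` carrier D"
  proof (intro equalityI subsetI)
    fix C assume "C \<in> carrier (fundamental_group X base)"
    then obtain p where p: "p \<in> loops_at X base" "C = loop_homotopy_rel X base `` {p}"
      by (auto simp: fundamental_group_def quotient_def)
    then obtain g where "lifts_to p g" using loop_imp_lifts_to by blast
    then show "C \<in> ?\<Theta> ` carrier D" using p homotopy_class_eq by (auto simp: lifts_to_def)
  next
    fix C assume "C \<in> ?\<Theta> ` carrier D"
    then obtain g where g: "g \<in> carrier D" "C = ?\<Theta> g" by blast
    then obtain p where p: "lifts_to p g" using ne by blast
    then have "C = loop_homotopy_rel X base `` {p}" using homotopy_class_eq g by simp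
    then show "C \<in> carrier (fundamental_group X base)"
      using lifts_to_imp_loop[OF p] by (simp add: fundamental_group_def quotientI)
  qed
  have "inj_on ?\<Theta> (carrier D)"
  proof (rule inj_onI)
    fix g g' assume g: "g \<in> carrier D" "g' \<in> carrier D" "?\<Theta> g = ?\<Theta> g'"
    obtain p where "lifts_to p g" using ne g by blast
    then show "g = g'"
      using g(3) homotopic_imp_lifts_to_same lifts_to_same_imp_homotopic by blast
  qed
  moreover have "?\<Theta> (g \<otimes> g') = ?\<Theta> g \<otimes>\<^bsub>fundamental_group X base\<^esub> ?\<Theta> g'"
    if g: "g \<in> carrier D" "g' \<in> carrier D" for g g'
  proof -
    have "?\<Theta> g \<otimes>\<^bsub>fundamental_group X base\<^esub> ?\<Theta> g' =
        (\<Union>p\<in>?\<Theta> g. \<Union>q\<in>?\<Theta> g'. loop_homotopy_rel X base `` {loop_concat p q})"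
      by (simp add: fundamental_group_def)
    also have "\<dots> = (\<Union>p\<in>?\<Theta> g. \<Union>q\<in>?\<Theta> g'. ?\<Theta> (g \<otimes> g'))"
      using homotopy_class_eq[OF lifts_to_concat] by simp
    also have "\<dots> = ?\<Theta> (g \<otimes> g')" using ne g by auto
    finally show ?thesis by simp
  qed
  ultimately show "?\<Theta> \<in> iso D (fundamental_group X base)"
    by (auto simp: iso_def hom_def bij_betw_def carr)
  have "lifts_to (\<lambda>_. base) \<one>"
    unfolding lifts_to_def by (auto simp: act_one intro!: exI[of _ "\<lambda>_. e0"])
  then show "?\<Theta> \<one> = \<one>\<^bsub>fundamental_group X base\<^esub>"
    by (simp add: fundamental_group_def homotopy_class_eq)
qed

text \<open>Associativity and inverses of loop classes are inherited from \<open>D\<close> and not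
  verified on paths.\<close>

corollary group_fundamental_group: "group (fundamental_group X base)"
  using iso_imp_img_group[OF deck_iso_fundamental_group(1)]
  by (simp add: deck_iso_fundamental_group(2))

corollary deck_isomorphic_fundamental_group: "D \<cong> fundamental_group X base"
  using deck_iso_fundamental_group(1) by (rule is_isoI)

end


section \<open>Quotient topologies\<close>

lemma quotient_lift_eq:
  assumes "equiv A r" "\<And>x y. (x, y) \<in> r \<Longrightarrow> f x = f y" "C \<in> A // r" "x \<in> C"
  shows "f (SOME x. x \<in> C) = f x"
proof -
  have "(SOME x. x \<in> C) \<in> C" using assms(4) by (rule someI)
  then have "((SOME x. x \<in> C), x) \<in> r"
    using in_quotient_imp_in_rel[OF assms(1,3)] assms(4) by simp
  then show ?thesis by (rule assms(2))
qed

lemma continuous_map_quotient_lift: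
  assumes r: "equiv (topspace X) r" and f: "continuous_map X Y f"
    and resp: "\<And>x y. (x, y) \<in> r \<Longrightarrow> f x = f y"
  shows "continuous_map (quotient_topology X r) Y (\<lambda>C. f (SOME x. x \<in> C))"
proof -
  have lift: "f (SOME x. x \<in> C) = f x" if "C \<in> topspace X // r" "x \<in> C" for C x
    using quotient_lift_eq[OF r _ that, of f] resp by blast
  have sub: "C \<subseteq> topspace X" "\<exists>x. x \<in> C" if "C \<in> topspace X // r" for C
    using that r in_quotient_imp_subset in_quotient_imp_non_empty by fastforce+
  have "f (SOME x. x \<in> C) \<in> topspace Y" if C: "C \<in> topspace X // r" for C
  proof -
    obtain x where "x \<in> C" using sub(2)[OF C] by blast
    then have "f (SOME x. x \<in> C) = f x" "x \<in> topspace X" using lift[OF C] sub(1)[OF C] by auto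
    then show ?thesis using continuous_map_image_subset_topspace[OF f] by auto
  qed
  moreover have "openin (quotient_topology X r) {C \<in> topspace X // r. f (SOME x. x \<in> C) \<in> V}"
    if V: "openin Y V" for V
  proof -
    have "\<Union>{C \<in> topspace X // r. f (SOME x. x \<in> C) \<in> V} = {x \<in> topspace X. f x \<in> V}"
    proof (intro equalityI subsetI)
      fix x assume "x \<in> \<Union>{C \<in> topspace X // r. f (SOME x. x \<in> C) \<in> V}"
      then obtain C where C: "C \<in> topspace X // r" "f (SOME x. x \<in> C) \<in> V" "x \<in> C" by blast
      then show "x \<in> {x \<in> topspace X. f x \<in> V}" using sub(1)[OF C(1)] lift[OF C(1,3)] by auto
    next
      fix x assume x: "x \<in> {x \<in> topspace X. f x \<in> V}"
      then have C: "r `` {x} \<in> topspace X // r" "x \<in> r `` {x}"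
        using equiv_class_self[OF r] by (auto intro: quotientI)
      then have "f (SOME y. y \<in> r `` {x}) \<in> V" using x lift[OF C] by simp
      then show "x \<in> \<Union>{C \<in> topspace X // r. f (SOME x. x \<in> C) \<in> V}" using C by blast
    qed
    then show ?thesis
      using openin_continuous_map_preimage[OF f V] by (simp add: openin_quotient_topology[OF r])
  qed
  ultimately show ?thesis
    by (simp add: continuous_map_def topspace_quotient_topology[OF r])
qed

lemma continuous_map_quotient_proj:
  assumes r: "equiv (topspace X) r"
  shows "continuous_map X (quotient_topology X r) (\<lambda>x. r `` {x})"
proof -
  have "openin X {x \<in> topspace X. r `` {x} \<in> U}" if U: "openin (quotient_topology X r) U" for U
  proof -
    have sub: "U \<subseteq> topspace X // r" and op: "openin X (\<Union>U)"
      using U by (auto simp: openin_quotient_topology[OF r])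
    have "{x \<in> topspace X. r `` {x} \<in> U} = \<Union>U"
    proof (intro equalityI subsetI)
      fix x assume "x \<in> {x \<in> topspace X. r `` {x} \<in> U}"
      then show "x \<in> \<Union>U" using equiv_class_self[OF r] by blast
    next
      fix x assume "x \<in> \<Union>U"
      then obtain C where C: "C \<in> U" "x \<in> C" by blast
      then obtain y where y: "C = r `` {y}" "y \<in> topspace X" using sub by (auto elim: quotientE)
      then have "r `` {x} = C" using C equiv_class_eq[OF r] by (metis Image_singleton_iff)
      moreover have "x \<in> topspace X" using openin_subset[OF op] C by blast
      ultimately show "x \<in> {x \<in> topspace X. r `` {x} \<in> U}" using C by simp
    qed
    then show ?thesis using op by simp
  qed
  then show ?thesis
    by (auto simp: continuous_map_def topspace_quotient_topology[OF r] intro: quotientI)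
qed

lemma compact_space_quotient_topology:
  assumes r: "equiv (topspace X) r" and K: "compactin X K"
    and surj: "\<And>x. x \<in> topspace X \<Longrightarrow> \<exists>y\<in>K. (x, y) \<in> r"
  shows "compact_space (quotient_topology X r)"
proof -
  have "(\<lambda>x. r `` {x}) ` K = topspace X // r"
  proof (intro equalityI subsetI)
    fix C assume "C \<in> topspace X // r"
    then obtain x where x: "x \<in> topspace X" "C = r `` {x}" by (auto elim: quotientE)
    then obtain y where "y \<in> K" "(x, y) \<in> r" using surj by blast
    then show "C \<in> (\<lambda>x. r `` {x}) ` K" using x equiv_class_eq[OF r] by blast
  qed (use compactin_subset_topspace[OF K] in \<open>auto intro: quotientI\<close>)
  then show ?thesis
    using image_compactin[OF K continuous_map_quotient_proj[OF r]]
    by (simp add: compact_space_def topspace_quotient_topology[OF r])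
qed


section \<open>The integer affine action on \<open>\<real>\<^sup>2 \<times> \<real>\<close>\<close>

abbreviation rmat :: "int^2^2 \<Rightarrow> real^2^2" where "rmat \<equiv> map_matrix real_of_int"

definition rvec :: "int^2 \<Rightarrow> real^2" where "rvec w = (\<chi> i. real_of_int (w $ i))"

lemma rvec_nth [simp]: "rvec w $ i = real_of_int (w $ i)"
  by (simp add: rvec_def)

lemma rmat_nth [simp]: "rmat A $ i $ j = real_of_int (A $ i $ j)"
  by (simp add: map_matrix_def)

lemma rmat_mult: "rmat (A ** B) = rmat A ** rmat B"
  by (simp add: vec_eq_iff matrix_mult_2)

lemma rmat_one [simp]: "rmat (mat 1) = mat 1"
  by (simp add: vec_eq_iff mat_def)

lemma rmat_rvec: "rmat A *v rvec w = rvec (A *v w)"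
  by (simp add: vec_eq_iff matrix_vector_mult_def)

lemma rvec_add: "rvec (v + w) = rvec v + rvec w"
  and rvec_0 [simp]: "rvec 0 = 0"
  by (simp_all add: vec_eq_iff)

lemma torus_rel_iff: "(v, w) \<in> torus_rel \<longleftrightarrow> (\<exists>z. w = v + rvec z)"
proof
  assume "(v, w) \<in> torus_rel"
  then have "\<forall>i. \<exists>z. v $ i - w $ i = real_of_int z" by (auto simp: torus_rel_def elim!: Ints_cases)
  then obtain z where "\<And>i. v $ i - w $ i = real_of_int (z i)" by metis
  then have "w = v + rvec (\<chi> i. - z i)" by (simp add: vec_eq_iff algebra_simps)
  then show "\<exists>z. w = v + rvec z" ..
qed (auto simp: torus_rel_def)

lemma torus_rel_rmat:
  assumes "(v, w) \<in> torus_rel"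
  shows "(rmat A *v v, rmat A *v w) \<in> torus_rel"
  using assms by (auto simp: torus_rel_iff matrix_vector_right_distrib rmat_rvec)

lemma torus_rel_rmat_iff:
  assumes "det A = 1"
  shows "(rmat A *v v, rmat A *v w) \<in> torus_rel \<longleftrightarrow> (v, w) \<in> torus_rel"
proof
  assume "(rmat A *v v, rmat A *v w) \<in> torus_rel"
  from torus_rel_rmat[OF this, of "adj2 A"] show "(v, w) \<in> torus_rel"
    by (simp add: matrix_vector_mul_assoc adj2_mult assms flip: rmat_mult)
qed (rule torus_rel_rmat)

lemma torus_action_class:
  assumes "det A = 1"
  shows "torus_action A (torus_rel `` {v}) = torus_rel `` {rmat A *v v}"
proof (intro equalityI subsetI)
  fix w assume w: "w \<in> torus_rel `` {rmat A *v v}"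
  have "w = rmat A *v (rmat (adj2 A) *v w)"
    by (simp add: matrix_vector_mul_assoc adj2_mult assms flip: rmat_mult)
  moreover from this have "(v, rmat (adj2 A) *v w) \<in> torus_rel"
    using w torus_rel_rmat_iff[OF assms] by (metis Image_singleton_iff)
  ultimately show "w \<in> torus_action A (torus_rel `` {v})"
    unfolding torus_action_def by blast
qed (auto simp: torus_action_def torus_rel_rmat)

text \<open>The sign in \<open>t - real_of_int k\<close> follows the gluing: \<open>(0, 1)\<close>
  moves the end \<open>(v, 1)\<close> of the slab to height 0 and applies \<open>A\<close> to
  \<open>v\<close>, just as the mapping torus identifies \<open>(x, 1)\<close> with
  \<open>(f x, 0)\<close>.\<close>

definition deck_act :: "int^2^2 \<Rightarrow> (int^2) \<times> int \<Rightarrow> (real^2) \<times> real \<Rightarrow> (real^2) \<times> real" where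
  "deck_act A = (\<lambda>(w, k) (v, t). (rmat (A [**] k) *v v + rvec w, t - real_of_int k))"

section \<open>An embedding of the orbit space into a Euclidean space\<close>

definition torus_embed :: "real^2 \<Rightarrow> complex \<times> complex" where
  "torus_embed v = (cis (2 * pi * v $ 1), cis (2 * pi * v $ 2))"

lemma cis_eq_cis_iff: "cis (2 * pi * x) = cis (2 * pi * y) \<longleftrightarrow> x - y \<in> \<int>"
proof -
  have "cis (2 * pi * x) = cis (2 * pi * y) \<longleftrightarrow> (\<exists>n::int. 2 * pi * x = 2 * pi * y + 2 * pi * n)"
    using sin_cos_eq_iff[of "2 * pi * x" "2 * pi * y"] by (auto simp: complex_eq_iff)
  also have "\<dots> \<longleftrightarrow> (\<exists>n::int. x = y + n)"
    by (simp flip: distrib_left)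
  also have "\<dots> \<longleftrightarrow> x - y \<in> \<int>"
    by (auto simp: Ints_def algebra_simps)
  finally show ?thesis .
qed

lemma torus_embed_eq_iff: "torus_embed v = torus_embed w \<longleftrightarrow> (v, w) \<in> torus_rel"
  by (simp add: torus_embed_def cis_eq_cis_iff torus_rel_def forall_2)

lemma continuous_on_matrix_vector_mult_2 [continuous_intros]:
  fixes M :: "real^2^2"
  shows "continuous_on S f \<Longrightarrow> continuous_on S (\<lambda>x. M *v f x)"
  by (rule continuous_on_compose2[OF matrix_vector_mult_linear_continuous_on[of UNIV]]) auto

lemma continuous_on_torus_embed [continuous_intros]:
  "continuous_on S f \<Longrightarrow> continuous_on S (\<lambda>x. torus_embed (f x))"
  unfolding torus_embed_def by (intro continuous_intros)

text \<open>
  The fibre coordinate \<open>a\<close> is visible for \<open>0 < s < 1\<close> in the second component; near the glued ends the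
  third component shows \<open>a\<close> at \<open>s = 0\<close> and the image \<open>b\<close> of \<open>a\<close> under the monodromy at \<open>s = 1\<close>.
\<close>

definition glue :: "complex \<times> complex \<Rightarrow> complex \<times> complex \<Rightarrow> real \<Rightarrow>
    complex \<times> (complex \<times> complex) \<times> (complex \<times> complex)" where
  "glue a b s = (cis (2 * pi * s), (s * (1 - s)) *\<^sub>R a, max 0 (1 - 2 * s) *\<^sub>R a + max 0 (2 * s - 1) *\<^sub>R b)"

lemma continuous_on_glue [continuous_intros]:
  "\<lbrakk>continuous_on S f; continuous_on S g; continuous_on S h\<rbrakk> \<Longrightarrow>
     continuous_on S (\<lambda>x. glue (f x) (g x) (h x))"
  unfolding glue_def by (intro continuous_intros)

lemma glue_eqD:
  assumes "glue a b s = glue a' b' s'" "s \<in> {0..1}" "s' \<in> {0..1}"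
  shows "s = s' \<and> (if s < 1 then a = a' else b = b') \<or> s = 0 \<and> s' = 1 \<and> a = b' \<or> s = 1 \<and> s' = 0 \<and> b = a'"
proof -
  have "s - s' \<in> \<int>" using assms(1) by (simp add: glue_def cis_eq_cis_iff)
  then obtain n :: int where n: "s - s' = n" by (auto elim: Ints_cases)
  then have "\<bar>real_of_int n\<bar> \<le> 1" using assms(2,3) by auto
  then have "\<bar>n\<bar> \<le> 1" by linarith
  then consider "n = 0" | "n = 1" | "n = -1" by linarith
  then show ?thesis
  proof cases
    case 1
    then have "s = s'" using n by simp
    moreover consider "s = 0" | "s = 1" | "0 < s" "s < 1" using assms(2) by fastforce
    then have "if s < 1 then a = a' else b = b'"
      using assms(1) \<open>s = s'\<close> by cases (auto simp: glue_def)
    ultimately show ?thesis by simp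
  next
    case 2
    then have "s = 1" "s' = 0" using n assms(2,3) by auto
    then show ?thesis using assms(1) by (simp add: glue_def)
  next
    case 3
    then have "s = 0" "s' = 1" using n assms(2,3) by auto
    then show ?thesis using assms(1) by (simp add: glue_def)
  qed
qed

definition slab_embed :: "int^2^2 \<Rightarrow> real^2 \<Rightarrow> real \<Rightarrow> complex \<times> (complex \<times> complex) \<times> (complex \<times> complex)" where
  "slab_embed A v s = glue (torus_embed v) (torus_embed (rmat A *v v)) s"

lemma slab_embed_1: "slab_embed A v 1 = slab_embed A (rmat A *v v) 0"
  by (simp add: slab_embed_def glue_def)

lemma slab_embed_cong: "(v, w) \<in> torus_rel \<Longrightarrow> slab_embed A v s = slab_embed A w s"
  using torus_rel_rmat[of v w A] by (simp add: slab_embed_def flip: torus_embed_eq_iff)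

lemma slab_embed_eq_iff:
  assumes "s \<in> {0..<1}" "s' \<in> {0..<1}"
  shows "slab_embed A v s = slab_embed A w s' \<longleftrightarrow> s = s' \<and> (v, w) \<in> torus_rel"
proof
  assume "slab_embed A v s = slab_embed A w s'"
  from glue_eqD[OF this[unfolded slab_embed_def]] assms show "s = s' \<and> (v, w) \<in> torus_rel"
    by (auto simp: torus_embed_eq_iff)
qed (auto intro: slab_embed_cong)

text \<open>The deck transformation \<open>(0, \<lfloor>t\<rfloor>)\<close> moves
  \<open>(v, t)\<close> into the slab over [0, 1). There only lattice translations remain to be
  factored out, which \<open>torus_embed\<close> does.\<close>

definition bundle_embed :: "int^2^2 \<Rightarrow> (real^2) \<times> real \<Rightarrow> complex \<times> (complex \<times> complex) \<times> (complex \<times> complex)" where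
  "bundle_embed A = (\<lambda>(v, t). slab_embed A (rmat (A [**] \<lfloor>t\<rfloor>) *v v) (frac t))"

context
  fixes A :: "int^2^2" assumes A: "det A = 1"
begin

text \<open>The right end \<open>t = k + 1\<close> is included thanks to
  \<open>slab_embed_1\<close>. The slabs are then closed, and continuity can be pasted across the
  jumps of the floor function.\<close>

lemma bundle_embed_slab:
  assumes "t \<in> {real_of_int k..real_of_int k + 1}"
  shows "bundle_embed A (v, t) = slab_embed A (rmat (A [**] k) *v v) (t - k)"
proof (cases "t = real_of_int k + 1")
  case True
  then have "t = real_of_int (k + 1)" by simp
  then have "bundle_embed A (v, t) = slab_embed A (rmat (A [**] (1 + k)) *v v) 0"
    unfolding bundle_embed_def by (simp add: add.commute)
  also have "\<dots> = slab_embed A (rmat (A [**] k) *v v) 1"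
    by (simp add: slab_embed_1 mat_pow_add mat_pow_1 A rmat_mult matrix_vector_mul_assoc)
  finally show ?thesis using True by simp
next
  case False
  then have "\<lfloor>t\<rfloor> = k" using assms by (auto simp: floor_eq_iff)
  then show ?thesis by (simp add: bundle_embed_def frac_def)
qed

lemma bundle_embed_continuous: "continuous_on UNIV (bundle_embed A)"
proof -
  have slab: "continuous_on (UNIV \<times> {real_of_int k..real_of_int k + 1}) (bundle_embed A)" for k
  proof (rule continuous_on_eq)
    show "continuous_on (UNIV \<times> {real_of_int k..real_of_int k + 1})
        (\<lambda>x. slab_embed A (rmat (A [**] k) *v fst x) (snd x - k))"
      unfolding slab_embed_def
      by (intro continuous_intros)
  qed (auto simp: bundle_embed_slab)
  have "isCont (bundle_embed A) (v, t)" for v t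
  proof -
    define k where "k = \<lfloor>t\<rfloor>"
    \<comment> \<open>An integer \<open>t\<close> lies on the wall between the slabs of
      \<open>k - 1\<close> and \<open>k\<close>, so a neighbourhood of it needs both.\<close>
    let ?S = "UNIV \<times> {real_of_int (k - 1)<..<real_of_int k + 1} :: ((real^2) \<times> real) set"
    have "continuous_on (UNIV \<times> {real_of_int (k - 1)..real_of_int (k - 1) + 1} \<union>
        UNIV \<times> {real_of_int k..real_of_int k + 1}) (bundle_embed A)"
      by (intro continuous_on_closed_Un slab closed_Times) auto
    then have "continuous_on ?S (bundle_embed A)"
      by (rule continuous_on_subset) auto
    moreover have "open ?S" "(v, t) \<in> ?S"
      by (auto simp: k_def intro!: open_Times) linarith+
    ultimately show ?thesis by (simp add: continuous_on_eq_continuous_at)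
  qed
  then show ?thesis by (simp add: continuous_at_imp_continuous_on)
qed

lemma bundle_embed_eq_iff:
  "bundle_embed A x = bundle_embed A y \<longleftrightarrow> (\<exists>g\<in>carrier (semidirect A). y = deck_act A g x)"
proof -
  obtain v t v' t' where xy: "x = (v, t)" "y = (v', t')" by fastforce
  have frac: "frac t \<in> {0..<1}" for t :: real by (simp add: frac_lt_1)
  have iff: "bundle_embed A x = bundle_embed A y \<longleftrightarrow>
      frac t = frac t' \<and> (rmat (A [**] \<lfloor>t\<rfloor>) *v v, rmat (A [**] \<lfloor>t'\<rfloor>) *v v') \<in> torus_rel"
    by (simp add: xy bundle_embed_def slab_embed_eq_iff[OF frac frac])
  show ?thesis
  proof
    assume "bundle_embed A x = bundle_embed A y"
    then obtain z where eq: "frac t = frac t'"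
      and z: "rmat (A [**] \<lfloor>t'\<rfloor>) *v v' = rmat (A [**] \<lfloor>t\<rfloor>) *v v + rvec z"
      unfolding iff torus_rel_iff by blast
    define k where "k = \<lfloor>t\<rfloor> - \<lfloor>t'\<rfloor>"
    have "v' = rmat (A [**] (- \<lfloor>t'\<rfloor>)) *v (rmat (A [**] \<lfloor>t'\<rfloor>) *v v')"
      by (simp add: matrix_vector_mul_assoc mat_pow_cancel A flip: rmat_mult)
    also have "\<dots> = rmat (A [**] k) *v v + rvec (A [**] (- \<lfloor>t'\<rfloor>) *v z)"
      unfolding z
      by (simp add: k_def matrix_vector_right_distrib matrix_vector_mul_assoc rmat_rvec A
        flip: rmat_mult mat_pow_add)
    finally have "y = deck_act A (A [**] (- \<lfloor>t'\<rfloor>) *v z, k) x"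
      using eq by (simp add: xy deck_act_def k_def frac_def)
    then show "\<exists>g\<in>carrier (semidirect A). y = deck_act A g x" by auto
  next
    assume "\<exists>g\<in>carrier (semidirect A). y = deck_act A g x"
    then obtain w k where wk: "v' = rmat (A [**] k) *v v + rvec w" "t' = t - real_of_int k"
      by (auto simp: xy deck_act_def)
    have fl: "\<lfloor>t'\<rfloor> = \<lfloor>t\<rfloor> - k" using wk by simp
    have "rmat (A [**] \<lfloor>t'\<rfloor>) *v v' = rmat (A [**] \<lfloor>t\<rfloor>) *v v + rvec (A [**] \<lfloor>t'\<rfloor> *v w)"
      by (simp add: wk(1) fl matrix_vector_right_distrib matrix_vector_mul_assoc rmat_rvec A
        flip: rmat_mult mat_pow_add)
    then show "bundle_embed A x = bundle_embed A y"
      unfolding iff torus_rel_iff using fl wk(2) by (auto simp: frac_def)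
  qed
qed

lemma torus_rel_unit_square: "\<exists>w\<in>cbox 0 1. (v, w) \<in> torus_rel"
proof (intro bexI)
  show "(\<chi> i. frac (v $ i)) \<in> cbox 0 (1 :: real^2)"
    by (auto simp: mem_box_cart frac_lt_1 less_imp_le)
  show "(v, \<chi> i. frac (v $ i)) \<in> torus_rel"
    by (simp add: torus_rel_def frac_def)
qed

lemma bundle_embed_cocompact: "bundle_embed A ` (cbox 0 1 \<times> {0..1}) = range (bundle_embed A)"
proof (intro equalityI subsetI)
  fix z assume "z \<in> range (bundle_embed A)"
  then obtain v t where "z = bundle_embed A (v, t)" by auto
  then have z: "z = slab_embed A (rmat (A [**] \<lfloor>t\<rfloor>) *v v) (frac t)" by (simp add: bundle_embed_def)
  obtain w where w: "w \<in> cbox 0 1" "(rmat (A [**] \<lfloor>t\<rfloor>) *v v, w) \<in> torus_rel"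
    using torus_rel_unit_square by blast
  have "z = bundle_embed A (w, frac t)"
    unfolding z slab_embed_cong[OF w(2)] bundle_embed_def by (simp add: mat_pow_0 A)
  then show "z \<in> bundle_embed A ` (cbox 0 1 \<times> {0..1})"
    using w(1) frac_lt_1[of t] by (auto simp: less_imp_le)
qed auto

text \<open>The points \<open>y\<close> and \<open>deck_act A g y\<close> are less than 1 apart.
  This first forces the integer shift to vanish, and what is left is a translation by an integer
  vector of norm below 1.\<close>

lemma deck_act_wandering:
  assumes "dist x y < 1 / 2" "dist x (deck_act A g y) < 1 / 2"
  shows "g = \<one>\<^bsub>semidirect A\<^esub>"
proof -
  obtain w k v t where g: "g = (w, k)" "y = (v, t)" by fastforce
  have d: "dist y (deck_act A g y) < 1" using assms dist_triangle_half_r by blast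
  have "\<bar>real_of_int k\<bar> < 1"
    using le_less_trans[OF dist_snd_le d] by (simp add: g deck_act_def dist_real_def)
  then have k: "k = 0" by linarith
  have "norm (rvec w) < 1"
    using le_less_trans[OF dist_fst_le d] by (simp add: g deck_act_def k mat_pow_0 A dist_norm)
  then have "\<bar>real_of_int (w $ i)\<bar> < 1" for i
    using le_less_trans[OF component_le_norm_cart[of "rvec w" i]] by simp
  then have "w $ i = 0" for i by (metis of_int_abs of_int_less_1_iff zabs_less_one_iff)
  then show ?thesis by (simp add: g k vec_eq_iff)
qed

lemma deck_action_bundle: "deck_action (semidirect A) (deck_act A) (bundle_embed A)"
proof (intro deck_action.intro deck_action_axioms.intro)
  show "group (semidirect A)" by (rule group_semidirect[OF A])
  show "deck_act A \<one>\<^bsub>semidirect A\<^esub> x = x" for x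
    by (cases x) (simp add: deck_act_def mat_pow_0 A)
  show "deck_act A (g \<otimes>\<^bsub>semidirect A\<^esub> g') x = deck_act A g (deck_act A g' x)" for g g' x
    by (cases x; cases g; cases g')
       (simp add: deck_act_def mat_pow_add A rmat_mult rvec_add rmat_rvec matrix_vector_mul_assoc
         matrix_vector_right_distrib)
  show "continuous_on UNIV (deck_act A g)" for g
    unfolding deck_act_def case_prod_beta
    by (intro continuous_intros)
  show "\<exists>U. open U \<and> x \<in> U \<and> (\<forall>g\<in>carrier (semidirect A). \<forall>y\<in>U. deck_act A g y \<in> U \<longrightarrow> g = \<one>\<^bsub>semidirect A\<^esub>)" for x
    using deck_act_wandering[of x] by (intro exI[of _ "ball x (1/2)"]) auto
  show "\<exists>K. compact K \<and> bundle_embed A ` K = range (bundle_embed A)"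
    using bundle_embed_cocompact by (intro exI[of _ "cbox 0 1 \<times> {0..1}"]) (simp add: compact_Times)
qed (simp_all only: bundle_embed_continuous bundle_embed_eq_iff)


section \<open>The torus bundle as an orbit space\<close>

definition fibre_embed :: "(real^2) set \<times> real \<Rightarrow> complex \<times> (complex \<times> complex) \<times> (complex \<times> complex)" where
  "fibre_embed p = slab_embed A (SOME v. v \<in> fst p) (snd p)"

lemma fibre_embed_class: "fibre_embed (torus_rel `` {v}, s) = slab_embed A v s"
proof -
  have "v \<in> torus_rel `` {v}" by (simp add: torus_rel_def)
  then have "(SOME v'. v' \<in> torus_rel `` {v}) \<in> torus_rel `` {v}" by (rule someI)
  then show ?thesis by (simp add: fibre_embed_def slab_embed_cong)
qed

lemma continuous_map_fibre_embed:
  "continuous_map (prod_topology torus (top_of_set {0..1})) euclidean fibre_embed"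
proof -
  let ?X = "prod_topology torus (top_of_set {0..1::real})"
  have "continuous_map torus euclidean (\<lambda>c. f (SOME v. v \<in> c))"
    if "continuous_on UNIV f" "\<And>v w. (v, w) \<in> torus_rel \<Longrightarrow> f v = f w" for f :: "real^2 \<Rightarrow> complex \<times> complex"
    unfolding torus_def using that by (intro continuous_map_quotient_lift equiv_torus_rel) auto
  note lift = continuous_map_compose[OF continuous_map_fst this, unfolded o_def]
  have "continuous_map ?X euclidean (\<lambda>p. torus_embed (SOME v. v \<in> fst p))"
    by (rule lift) (auto simp: torus_embed_eq_iff intro!: continuous_intros)
  moreover have "continuous_map ?X euclidean (\<lambda>p. torus_embed (rmat A *v (SOME v. v \<in> fst p)))"
    by (rule lift[of "\<lambda>v. torus_embed (rmat A *v v)"])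
       (auto simp: torus_embed_eq_iff torus_rel_rmat intro!: continuous_intros)
  moreover have "continuous_map ?X euclidean snd"
    by (rule continuous_map_into_fulltopology[OF continuous_map_snd])
  ultimately have "continuous_map ?X (prod_topology euclidean (prod_topology euclidean euclidean))
      (\<lambda>p. (torus_embed (SOME v. v \<in> fst p), torus_embed (rmat A *v (SOME v. v \<in> fst p)), snd p))"
    by (intro continuous_map_pairedI)
  then have "continuous_map ?X euclidean
      (\<lambda>p. (torus_embed (SOME v. v \<in> fst p), torus_embed (rmat A *v (SOME v. v \<in> fst p)), snd p))"
    by (simp add: euclidean_product_topology)
  moreover have "continuous_map euclidean euclidean (\<lambda>x. glue (fst x) (fst (snd x)) (snd (snd x)))"
    by (simp, intro continuous_intros)
  ultimately have "continuous_map ?X euclidean ((\<lambda>x. glue (fst x) (fst (snd x)) (snd (snd x))) \<circ>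
      (\<lambda>p. (torus_embed (SOME v. v \<in> fst p), torus_embed (rmat A *v (SOME v. v \<in> fst p)), snd p)))"
    by (rule continuous_map_compose)
  then show ?thesis by (simp add: o_def fibre_embed_def[abs_def] slab_embed_def)
qed

text \<open>By \<open>glue_eqD\<close>, points with equal values coincide or differ by a single
  gluing step in one of its two directions, so no longer chains of the generated equivalence
  occur.\<close>

lemma fibre_embed_eq_iff:
  assumes "p \<in> topspace torus \<times> {0..1}" "q \<in> topspace torus \<times> {0..1}"
  shows "fibre_embed p = fibre_embed q \<longleftrightarrow> (p, q) \<in> mapping_torus_rel torus (torus_action A)"
proof
  assume "(p, q) \<in> mapping_torus_rel torus (torus_action A)"
  then have "equivclp (\<lambda>p q. \<exists>x\<in>topspace torus. p = (x, 1) \<and> q = (torus_action A x, 0)) p q"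
    by (simp add: mapping_torus_rel_def)
  then show "fibre_embed p = fibre_embed q"
  proof (induction rule: equivclp_induct)
    case (step y z)
    have "fibre_embed (x, 1) = fibre_embed (torus_action A x, 0)"
      if x: "x \<in> topspace torus" for x
    proof -
      obtain v where "x = torus_rel `` {v}" using x by (auto simp: topspace_torus elim: quotientE)
      then show ?thesis by (simp add: torus_action_class A fibre_embed_class slab_embed_1)
    qed
    then show ?case using step by auto
  qed simp
next
  assume eq: "fibre_embed p = fibre_embed q"
  obtain v s where p: "p = (torus_rel `` {v}, s)" "s \<in> {0..1}"
    using assms(1) by (auto simp: topspace_torus elim!: quotientE)
  obtain w s' where q: "q = (torus_rel `` {w}, s')" "s' \<in> {0..1}"
    using assms(2) by (auto simp: topspace_torus elim!: quotientE)
  let ?R = "\<lambda>p q. \<exists>x\<in>topspace torus. p = (x, 1::real) \<and> q = (torus_action A x, 0)"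
  have cls: "(v, w) \<in> torus_rel \<Longrightarrow> torus_rel `` {v} = torus_rel `` {w}" for v w
    using equiv_class_eq[OF equiv_torus_rel] .
  have step: "?R (torus_rel `` {v}, 1) (torus_rel `` {rmat A *v v}, 0)" for v
    by (auto simp: topspace_torus torus_action_class A intro!: quotientI)
  have "slab_embed A v s = slab_embed A w s'" using eq by (simp add: p q fibre_embed_class)
  from glue_eqD[OF this[unfolded slab_embed_def] p(2) q(2), unfolded torus_embed_eq_iff torus_rel_rmat_iff[OF A]]
  consider "s = s'" "(v, w) \<in> torus_rel" | "s = 0" "s' = 1" "(v, rmat A *v w) \<in> torus_rel"
    | "s = 1" "s' = 0" "(rmat A *v v, w) \<in> torus_rel"
    by (auto split: if_splits)
  then have "equivclp ?R p q"
  proof cases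
    case 1
    then show ?thesis using cls by (simp add: p q)
  next
    case 2
    then have "?R q p" using step[of w] cls by (simp add: p q)
    then show ?thesis by (intro equivclp_sym[OF r_into_equivclp])
  next
    case 3
    then have "?R p q" using step[of v] cls by (simp add: p q)
    then show ?thesis by (rule r_into_equivclp)
  qed
  then show "(p, q) \<in> mapping_torus_rel torus (torus_action A)"
    using assms by (simp add: mapping_torus_rel_def)
qed

lemma compact_space_torus: "compact_space torus"
  unfolding torus_def
proof (rule compact_space_quotient_topology[OF equiv_torus_rel])
  show "compactin euclidean (cbox 0 (1 :: real^2))" by simp
qed (rule torus_rel_unit_square)

lemma compact_space_torus_bundle: "compact_space (torus_bundle A)"
proof -
  let ?X = "prod_topology torus (top_of_set {0..1::real})"
  have "compact_space ?X"
    by (simp add: compact_space_prod_topology compact_space_torus compact_space_subtopology)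
  then have "compactin ?X (topspace ?X)" by (simp add: compact_space_def)
  then show ?thesis
    unfolding torus_bundle_def mapping_torus_def
    by (rule compact_space_quotient_topology[OF equiv_mapping_torus_rel])
       (use equiv_mapping_torus_rel in \<open>blast dest: equiv_class_self\<close>)
qed

text \<open>Compactness of the bundle and the Hausdorff property of the image make the continuous
  bijection a homeomorphism, so the open sets of the iterated quotient are never examined.\<close>

lemma torus_bundle_homeomorphic_map:
  "homeomorphic_map (torus_bundle A) (top_of_set (range (bundle_embed A))) (\<lambda>C. fibre_embed (SOME p. p \<in> C))"
proof (rule continuous_imp_homeomorphic_map)
  let ?X = "prod_topology torus (top_of_set {0..1::real})" and ?r = "mapping_torus_rel torus (torus_action A)"
  let ?f = "\<lambda>C. fibre_embed (SOME p. p \<in> C)"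
  note eq = equiv_mapping_torus_rel[of torus "torus_action A"]
  have top: "topspace ?X = topspace torus \<times> {0..1}" by simp
  have resp: "fibre_embed p = fibre_embed q" if "(p, q) \<in> ?r" for p q
    using that fibre_embed_eq_iff by (auto simp: mapping_torus_rel_def)
  have lift: "?f C = fibre_embed p" if "C \<in> topspace ?X // ?r" "p \<in> C" for C p
    using quotient_lift_eq[OF eq resp that] .
  have tb: "topspace (torus_bundle A) = topspace ?X // ?r"
    by (simp add: topspace_torus_bundle)
  have rep: "\<exists>p\<in>topspace ?X. C = ?r `` {p} \<and> p \<in> C" if "C \<in> topspace ?X // ?r" for C
    using that equiv_class_self[OF eq] by (auto elim!: quotientE)
  have img: "?f ` topspace (torus_bundle A) = fibre_embed ` topspace ?X"
  proof (intro equalityI subsetI)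
    fix z assume "z \<in> fibre_embed ` topspace ?X"
    then obtain p where p: "p \<in> topspace ?X" "z = fibre_embed p" by blast
    have C: "?r `` {p} \<in> topspace ?X // ?r" "p \<in> ?r `` {p}"
      using quotientI[OF p(1)] equiv_class_self[OF eq p(1)] by blast+
    show "z \<in> ?f ` topspace (torus_bundle A)"
      unfolding tb p(2) lift[OF C, symmetric] using C(1) by (rule imageI)
  next
    fix z assume "z \<in> ?f ` topspace (torus_bundle A)"
    then obtain C where C: "C \<in> topspace ?X // ?r" "z = ?f C" unfolding tb by blast
    then show "z \<in> fibre_embed ` topspace ?X" using rep[OF C(1)] lift by auto
  qed
  also have "fibre_embed ` topspace ?X = range (bundle_embed A)"
  proof (intro equalityI subsetI)
    fix z assume "z \<in> fibre_embed ` topspace ?X"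
    then obtain v s where vs: "z = fibre_embed (torus_rel `` {v}, s)" "s \<in> {0..1}"
      by (auto simp: topspace_torus elim!: quotientE)
    then have "z = bundle_embed A (v, s)"
      using bundle_embed_slab[of s 0 v] by (simp add: fibre_embed_class mat_pow_0 A)
    then show "z \<in> range (bundle_embed A)" by simp
  next
    fix z assume "z \<in> range (bundle_embed A)"
    then obtain v t where "z = bundle_embed A (v, t)" by auto
    then have "z = fibre_embed (torus_rel `` {rmat (A [**] \<lfloor>t\<rfloor>) *v v}, frac t)"
      by (simp add: bundle_embed_def fibre_embed_class)
    then show "z \<in> fibre_embed ` topspace ?X"
      using frac_lt_1[of t] by (auto simp: topspace_torus less_imp_le intro!: imageI quotientI)
  qed
  finally have img': "?f ` topspace (torus_bundle A) = range (bundle_embed A)" .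
  then show "?f ` topspace (torus_bundle A) = topspace (top_of_set (range (bundle_embed A)))" by simp
  have "continuous_map (torus_bundle A) euclidean ?f"
    unfolding torus_bundle_def mapping_torus_def
    by (rule continuous_map_quotient_lift[OF eq continuous_map_fibre_embed resp])
  then show "continuous_map (torus_bundle A) (top_of_set (range (bundle_embed A))) ?f"
    using img' by (auto simp: continuous_map_in_subtopology)
  show "inj_on ?f (topspace (torus_bundle A))"
  proof (rule inj_onI)
    fix C D assume CD: "C \<in> topspace (torus_bundle A)" "D \<in> topspace (torus_bundle A)" "?f C = ?f D"
    obtain p where p: "p \<in> topspace ?X" "C = ?r `` {p}" "p \<in> C" 
      using rep[OF CD(1)[unfolded tb]] by blast
    obtain q where q: "q \<in> topspace ?X" "D = ?r `` {q}" "q \<in> D" 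
      using rep[OF CD(2)[unfolded tb]] by blast
    have "fibre_embed p = fibre_embed q" 
      using CD(3) lift[OF CD(1)[unfolded tb] p(3)] lift[OF CD(2)[unfolded tb] q(3)] by simp
    then have "(p, q) \<in> ?r" using fibre_embed_eq_iff p q unfolding top by blast
    then show "C = D" unfolding p(2) q(2) by (rule equiv_class_eq[OF eq])
  qed
  show "compact_space (torus_bundle A)" by (rule compact_space_torus_bundle)
  show "Hausdorff_space (top_of_set (range (bundle_embed A)))"
    by (simp add: Hausdorff_space_subtopology)
qed

text \<open>\<open>orbit_space\<close> admits every \<open>e0\<close>, and each \<open>x\<close> is
  the projection of some \<open>e\<close>. All base points are thus treated alike, without paths
  between them.\<close>

theorem fundamental_group_torus_bundle:
  assumes "x \<in> topspace (torus_bundle A)"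
  shows "group (fundamental_group (torus_bundle A) x)"
    and "semidirect A \<cong> fundamental_group (torus_bundle A) x"
proof -
  obtain h h' where h: "homeomorphic_maps (torus_bundle A) (top_of_set (range (bundle_embed A))) h h'"
    using torus_bundle_homeomorphic_map unfolding homeomorphic_map_maps by blast
  have "h x \<in> range (bundle_embed A)"
    using h assms by (auto simp: homeomorphic_maps_def continuous_map_def)
  then obtain e where e: "h x = bundle_embed A e" by blast
  interpret orbit_space "semidirect A" "deck_act A" "bundle_embed A" "torus_bundle A" h h' e
    by (intro orbit_space.intro orbit_space_axioms.intro deck_action_bundle h)
  have "x = proj e" using h assms e by (simp add: proj_def homeomorphic_maps_def flip: e)
  then show "group (fundamental_group (torus_bundle A) x)"
      "semidirect A \<cong> fundamental_group (torus_bundle A) x"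
    using group_fundamental_group deck_isomorphic_fundamental_group by simp_all
qed

end


section \<open>The family of matrices\<close>

lemma isomorphic_profinite_completions_torus_bundles:
  assumes "b * c = a\<^sup>2 - 1" "coprime b c" "b' * c' = a\<^sup>2 - 1" "coprime b' c'"
    and x: "x \<in> topspace (torus_bundle (mat_abc a b c))"
    and y: "y \<in> topspace (torus_bundle (mat_abc a b' c'))"
  shows "isomorphic_profinite_completions (fundamental_group (torus_bundle (mat_abc a b c)) x)
           (fundamental_group (torus_bundle (mat_abc a b' c')) y)"
proof -
  let ?A = "mat_abc a b c" and ?B = "mat_abc a b' c'" and ?C = "mat_abc a (a\<^sup>2 - 1) 1"
  have det: "det ?A = 1" "det ?B = 1" using assms by (simp_all add: det_mat_abc)
  note G = group_semidirect[OF det(1)] fundamental_group_torus_bundle[OF det(1) x]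
  note H = group_semidirect[OF det(2)] fundamental_group_torus_bundle[OF det(2) y]
  have "isomorphic_profinite_completions (fundamental_group (torus_bundle ?A) x) (semidirect ?A)"
    using G iso_imp_isomorphic_profinite_completions group.iso_sym by blast
  also have "isomorphic_profinite_completions (semidirect ?A) (semidirect ?C)"
    by (rule mat_abc_isomorphic_profinite_completions) fact+
  also have "isomorphic_profinite_completions (semidirect ?C) (semidirect ?B)"
    using mat_abc_isomorphic_profinite_completions[OF assms(3,4)] H(1)
      isomorphic_profinite_completions_sym by blast
  also have "isomorphic_profinite_completions (semidirect ?B) (fundamental_group (torus_bundle ?B) y)"
    using H iso_imp_isomorphic_profinite_completions by blast
  finally show ?thesis .
qed

lemma fundamental_groups_isomorphic_imp_square:
  assumes "b * c = a\<^sup>2 - 1" "b' * c' = a\<^sup>2 - 1" "0 < c * c'" "c * c' < 2 * a - 2"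
    and x: "x \<in> topspace (torus_bundle (mat_abc a b c))"
    and y: "y \<in> topspace (torus_bundle (mat_abc a b' c'))"
    and iso: "fundamental_group (torus_bundle (mat_abc a b c)) x \<cong>
      fundamental_group (torus_bundle (mat_abc a b' c')) y"
  shows "\<exists>z. c * c' = z\<^sup>2"
proof (rule mat_abc_isomorphic_imp_square)
  have det: "det (mat_abc a b c) = 1" "det (mat_abc a b' c') = 1"
    using assms by (simp_all add: det_mat_abc)
  note G = fundamental_group_torus_bundle[OF det(1) x]
  note H = fundamental_group_torus_bundle[OF det(2) y]
  show "semidirect (mat_abc a b c) \<cong> semidirect (mat_abc a b' c')"
    using iso_trans[OF iso_trans[OF G(2) iso] group.iso_sym[OF group_semidirect[OF det(2)] H(2)]] .
qed fact+

text \<open>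
  With \<open>a = 1 + \<Prod>q\<^sub>i\<close> for distinct odd primes \<open>q\<^sub>i\<close>, every \<open>q\<^sub>i\<close> is a unitary divisor of \<open>a\<^sup>2 - 1\<close>.
\<close>

lemma ex_unitary_divisors:
  obtains q b :: "nat \<Rightarrow> int" and a :: int
  where "\<And>i. i < m \<Longrightarrow> b i * q i = a\<^sup>2 - 1" "\<And>i. i < m \<Longrightarrow> coprime (b i) (q i)"
    "\<And>i j. \<lbrakk>i < m; j < m; i \<noteq> j\<rbrakk> \<Longrightarrow> 0 < q i * q j \<and> q i * q j < 2 * a - 2 \<and> (\<forall>z. q i * q j \<noteq> z\<^sup>2)"
proof -
  define p where "p = enumerate {p::nat. prime p \<and> p \<noteq> 2}"
  have inf: "infinite {p::nat. prime p \<and> p \<noteq> 2}"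
  proof -
    have "{p::nat. prime p \<and> p \<noteq> 2} = {p. prime p} - {2}" by auto
    then show ?thesis using primes_infinite by simp
  qed
  have p: "prime (p i)" "p i \<noteq> 2" for i
    using enumerate_in_set[OF inf, of i] by (auto simp: p_def)
  have inj: "p i \<noteq> p j" if "i \<noteq> j" for i j
    using injD[OF inj_enumerate[OF inf], of i j] that unfolding p_def by blast
  define M where "M = (\<Prod>i<m. p i)"
  define c where "c i = (\<Prod>j\<in>{..<m} - {i}. p j)" for i
  have M: "M = p i * c i" if "i < m" for i
    using that by (simp add: M_def c_def prod.remove[of _ i])
  have cop: "coprime (c i) (p i)" if "i < m" for i
    unfolding c_def using p inj by (intro prod_coprime_left primes_coprime) auto
  have cop2: "coprime (M + 2) (p i)" if "i < m" for i
  proof -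
    \<comment> \<open>\<open>p i\<close> divides \<open>M\<close>, so it could divide
      \<open>M + 2\<close> only by dividing 2; this is why 2 is left out of the primes.\<close>
    have "\<not> p i dvd 2"
      using p by (metis primes_dvd_imp_eq two_is_prime_nat)
    moreover have "p i dvd M" using M[OF that] by simp
    ultimately have "\<not> p i dvd M + 2" using dvd_add_right_iff by blast
    then show ?thesis using p by (simp add: coprime_commute prime_imp_coprime)
  qed
  \<comment> \<open>For a = M + 1 one has a^2 - 1 = M (M + 2), so the cofactor of \<open>p i\<close>
    is \<open>c i * (M + 2)\<close>.\<close>
  show ?thesis
  proof (rule that[of "\<lambda>i. int (c i * (M + 2))" "\<lambda>i. int (p i)" "int M + 1"])
    fix i assume i: "i < m"
    show "int (c i * (M + 2)) * int (p i) = (int M + 1)\<^sup>2 - 1"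
      using M[OF i] by (simp add: power2_eq_square algebra_simps)
    show "coprime (int (c i * (M + 2))) (int (p i))"
      using cop[OF i] cop2[OF i] by (simp only: coprime_int_iff coprime_mult_left_iff)
  next
    fix i j assume ij: "i < m" "j < m" "i \<noteq> j"
    have "c i = p j * (\<Prod>k\<in>{..<m} - {i} - {j}. p k)"
      unfolding c_def using ij by (intro prod.remove) auto
    then have "M = p i * p j * (\<Prod>k\<in>{..<m} - {i} - {j}. p k)" using M[OF ij(1)] by simp
    moreover have "(\<Prod>k\<in>{..<m} - {i} - {j}. p k) \<ge> 1"
      using p prime_gt_0_nat by (intro prod_ge_1) (simp add: Suc_leI)
    \<comment> \<open>Here 2 a - 2 = 2 M, and \<open>M\<close> contains both primes, so the bound of
      the Pell descent holds with a factor 2 to spare.\<close>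
    ultimately have "p i * p j \<le> M" by simp
    moreover have "p i * p j > 0" using p prime_gt_0_nat by simp
    ultimately have "0 < int (p i) * int (p j)" "int (p i) * int (p j) \<le> int M"
      by (simp_all flip: of_nat_mult)
    then show "0 < int (p i) * int (p j) \<and> int (p i) * int (p j) < 2 * (int M + 1) - 2 \<and>
        (\<forall>z. int (p i) * int (p j) \<noteq> z\<^sup>2)"
      using prime_mult_prime_not_square[OF p(1) p(1) inj[OF ij(3)]] by auto
  qed
qed

theorem corollary1p4:
  fixes m :: nat
  assumes "m \<ge> 2"
  shows "\<exists>A :: nat \<Rightarrow> int^2^2.
           (\<forall>i<m. det (A i) = 1) \<and>
           (\<forall>i<m. \<forall>j<m. i \<noteq> j \<longrightarrow>
              (\<forall>x \<in> topspace (torus_bundle (A i)). \<forall>y \<in> topspace (torus_bundle (A j)).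
                 isomorphic_profinite_completions
                   (fundamental_group (torus_bundle (A i)) x)
                   (fundamental_group (torus_bundle (A j)) y) \<and>
                 \<not> fundamental_group (torus_bundle (A i)) x
                     \<cong> fundamental_group (torus_bundle (A j)) y))"
proof (rule ex_unitary_divisors[of m])
  fix q b :: "nat \<Rightarrow> int" and a :: int
  assume q: "\<And>i. i < m \<Longrightarrow> b i * q i = a\<^sup>2 - 1" "\<And>i. i < m \<Longrightarrow> coprime (b i) (q i)"
    "\<And>i j. \<lbrakk>i < m; j < m; i \<noteq> j\<rbrakk> \<Longrightarrow> 0 < q i * q j \<and> q i * q j < 2 * a - 2 \<and> (\<forall>z. q i * q j \<noteq> z\<^sup>2)"
  show ?thesis
  proof (intro exI[of _ "\<lambda>i. mat_abc a (b i) (q i)"] conjI allI impI ballI notI)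
    show "det (mat_abc a (b i) (q i)) = 1" if "i < m" for i
      using q(1)[OF that] by (rule det_mat_abc)
    fix i j x y
    assume ij: "i < m" "j < m" "i \<noteq> j" and x: "x \<in> topspace (torus_bundle (mat_abc a (b i) (q i)))"
      and y: "y \<in> topspace (torus_bundle (mat_abc a (b j) (q j)))"
    show "isomorphic_profinite_completions (fundamental_group (torus_bundle (mat_abc a (b i) (q i))) x)
        (fundamental_group (torus_bundle (mat_abc a (b j) (q j))) y)"
      using ij q by (intro isomorphic_profinite_completions_torus_bundles x y)
    assume "fundamental_group (torus_bundle (mat_abc a (b i) (q i))) x \<cong>
        fundamental_group (torus_bundle (mat_abc a (b j) (q j))) y"
    from fundamental_groups_isomorphic_imp_square[OF q(1) q(1) _ _ x y this] q(3)[OF ij] ij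
    show False by blast
  qed
qed

end
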